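(* Let $k \geq 4$ and $G$ a $k$-dicritical digraph. If $G$ is not $\overset \leftrightarrow K_k$, then \[\lvert A(G)\rvert \ge (k-1) \lvert V(G)\rvert + k-3.\]
   Context: Digraphs are simple (no loops, no parallel arcs; a digon, i.e. a pair of opposite arcs $uv,vu$, is allowed). A dicolouring of a digraph is a partition of its vertex set into sets inducing acyclic subdigraphs; the dichromatic number $\vec{\chi}(G)$ is the minimum number of parts of such a partition. A digraph $G$ is $k$-dicritical if $\vec{\chi}(G)=k$ and every proper subdigraph $H$ of $G$ satisfies $\vec{\chi}(H) \le k-1$. $\overset \leftrightarrow K_k$ denotes the complete symmetric digraph on $k$ vertices (every pair of distinct vertices joined by a digon). *)

theory Defs
  imports "Graph_Theory.Graph_Theory" "HOL-Library.Disjoint_Sets"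
begin

text \<open>
  A digraph is a \<^typ>\<open>('a, 'b) pre_digraph\<close> satisfying the predicate \<^locale>\<open>digraph\<close>: finite,
  without loops and without parallel arcs. Opposite arcs are allowed, and two opposite arcs form
  a \<^const>\<open>pre_digraph.cycle\<close> (of length two), so a digon is not acyclic.
\<close>

definition acyclic_digraph :: "('a, 'b) pre_digraph \<Rightarrow> bool" where
  "acyclic_digraph G \<longleftrightarrow> \<not> (\<exists>p. pre_digraph.cycle G p)"

definition dicolouring :: "('a, 'b) pre_digraph \<Rightarrow> 'a set set \<Rightarrow> bool" where
  "dicolouring G P \<longleftrightarrow> partition_on (verts G) P \<and> (\<forall>S\<in>P. acyclic_digraph (G \<restriction> S))"

text \<open>
  For a finite loopless digraph the minimum is attained over a nonempty set, since the partition
  into singletons is a dicolouring.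
\<close>

definition dichromatic_number :: "('a, 'b) pre_digraph \<Rightarrow> nat" where
  "dichromatic_number G = (LEAST n. \<exists>P. dicolouring G P \<and> finite P \<and> card P = n)"

text \<open>
  \<^const>\<open>subgraph\<close> forces equal tail and head maps, so a subdigraph different from \<open>G\<close> as
  a record is one that misses a vertex or an arc of \<open>G\<close>.
\<close>

definition dicritical :: "nat \<Rightarrow> ('a, 'b) pre_digraph \<Rightarrow> bool" where
  "dicritical k G \<longleftrightarrow> digraph G \<and> dichromatic_number G = k \<and>
     (\<forall>H. subgraph H G \<and> H \<noteq> G \<longrightarrow> dichromatic_number H \<le> k - 1)"

end

theory Submission
  imports Defs
begin

text \<open>
  Write \<open>n = k - 1\<close>. Only vertex-criticality is needed, and the bound is proved by induction on \<open>n\<close>,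
  starting from \<open>n = 2\<close>, where it says that all out-degrees are at least 2. If \<open>I\<close> is a maximal acyclic
  set of vertices of \<open>G\<close>, then \<open>G - I\<close> contains a vertex-critical subdigraph for \<open>n - 1\<close> colours, and
  each of its vertices has a further out-neighbour in \<open>I\<close>; so the excess \<open>|A| - n |V|\<close> of \<open>G\<close> is at
  least that of the subdigraph, and is larger if \<open>I\<close> contains a vertex of out-degree above \<open>n\<close>. Such a
  vertex exists by the directed version of Brooks' theorem.

  The subdigraph must not be a bidirected \<open>K\<^sub>n\<close>, so \<open>I\<close> has to hit every bidirected \<open>K\<^sub>n\<close> of \<open>G\<close>. When
  the excess is too small, two of these are disjoint or span a \<open>K\<^bsub>n+1\<^esub>\<close> minus an edge, and most of their
  vertices have at most one out-neighbour outside, so that an acyclic transversal can be chosen greedily.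
\<close>

subsection \<open>Colourings and critical sets\<close>

text \<open>Digraphs are encoded as an arc relation together with a vertex set, so that passing to
  fewer vertices leaves the relation unchanged.\<close>

definition acyclic_in :: "'a rel \<Rightarrow> 'a set \<Rightarrow> bool" where
  "acyclic_in E S \<longleftrightarrow> acyclic (Restr E S)"

definition colouring :: "nat \<Rightarrow> 'a rel \<Rightarrow> 'a set \<Rightarrow> ('a \<Rightarrow> nat) \<Rightarrow> bool" where
  "colouring n E V f \<longleftrightarrow> (\<forall>v\<in>V. f v < n) \<and> (\<forall>i. acyclic_in E {v\<in>V. f v = i})"

text \<open>The index is the number of colours that just fails: for irreflexive \<open>E\<close> the
  dichromatic number is \<open>n + 1\<close>.\<close>

definition vcritical :: "nat \<Rightarrow> 'a rel \<Rightarrow> 'a set \<Rightarrow> bool" where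
  "vcritical n E V \<longleftrightarrow>
     finite V \<and> \<not> (\<exists>f. colouring n E V f) \<and> (\<forall>v\<in>V. \<exists>f. colouring n E (V - {v}) f)"

definition clique :: "'a rel \<Rightarrow> 'a set \<Rightarrow> bool" where
  "clique E Q \<longleftrightarrow> (\<forall>u\<in>Q. \<forall>v\<in>Q. u \<noteq> v \<longrightarrow> (u, v) \<in> E)"

text \<open>In-degrees are written as out-degrees of the reversed relation.\<close>

abbreviation outdeg :: "'a rel \<Rightarrow> 'a set \<Rightarrow> 'a \<Rightarrow> nat" where
  "outdeg E V v \<equiv> card (E `` {v} \<inter> V)"

section \<open>Acyclic sets of vertices\<close>

lemma acyclic_in_mono: "acyclic_in E T \<Longrightarrow> S \<subseteq> T \<Longrightarrow> acyclic_in E S"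
  unfolding acyclic_in_def by (rule acyclic_subset) auto

lemma acyclic_in_converse [simp]: "acyclic_in (E\<inverse>) S = acyclic_in E S"
proof -
  have "Restr (E\<inverse>) S = (Restr E S)\<inverse>" by auto
  then show ?thesis unfolding acyclic_in_def by (simp only: acyclic_converse)
qed

lemma acyclic_in_empty [simp]: "acyclic_in E {}"
  unfolding acyclic_in_def by (simp add: acyclic_def)

text \<open>A walk inside the union that enters \<open>A\<close> stays there, so a closed walk lies
  in \<open>A\<close> or avoids \<open>A\<close> altogether.\<close>

lemma acyclic_in_closed_Un:
  assumes A: "acyclic_in E A" and B: "acyclic_in E B"
    and no: "\<And>a b. a \<in> A \<Longrightarrow> b \<in> B - A \<Longrightarrow> (a, b) \<notin> E"
  shows "acyclic_in E (A \<union> B)"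
proof -
  let ?r = "Restr E (A \<union> B)"
  have inA: "b \<in> A \<and> (a, b) \<in> (Restr E A)\<^sup>+" if "(a, b) \<in> ?r\<^sup>+" "a \<in> A" for a b
    using that
  proof (induction rule: trancl_induct)
    case (base y)
    then have "y \<in> A" using no by blast
    with base show ?case by (intro conjI r_into_trancl) auto
  next
    case (step y z)
    then have "y \<in> A" "z \<in> A" using no by blast+
    with step show ?case by (auto intro: trancl_into_trancl)
  qed
  have inB: "b \<in> A \<or> (a, b) \<in> (Restr E B)\<^sup>+" if "(a, b) \<in> ?r\<^sup>+" "a \<notin> A" for a b
    using that
  proof (induction rule: trancl_induct)
    case (base y)
    then show ?case by auto
  next
    case (step y z)
    show ?case
    proof (cases "z \<in> A")
      case False
      with step no have "y \<notin> A" "y \<in> B" "z \<in> B" by auto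
      with step have "(a, y) \<in> (Restr E B)\<^sup>+" "(y, z) \<in> Restr E B" by auto
      then show ?thesis by (meson trancl_into_trancl)
    qed simp
  qed
  show ?thesis
    unfolding acyclic_in_def
  proof (rule acyclicI, rule allI, rule notI)
    fix a assume a: "(a, a) \<in> ?r\<^sup>+"
    show False
    proof (cases "a \<in> A")
      case True
      then show False using inA[OF a] A by (auto simp: acyclic_in_def acyclic_def)
    next
      case False
      then show False using inB[OF a] B by (auto simp: acyclic_in_def acyclic_def)
    qed
  qed
qed

lemma acyclic_in_singleton: "(u, u) \<notin> E \<Longrightarrow> acyclic_in E {u}"
proof -
  assume "(u, u) \<notin> E"
  then have "Restr E {u} = {}" by auto
  then show ?thesis by (simp add: acyclic_in_def acyclic_def)
qed

lemma acyclic_in_insert_sink: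
  assumes "acyclic_in E S" "(u, u) \<notin> E" "E `` {u} \<inter> S = {}"
  shows "acyclic_in E (insert u S)"
  using acyclic_in_closed_Un[of E "{u}" S] acyclic_in_singleton[OF assms(2)] assms by auto

lemma acyclic_in_pair:
  assumes "irrefl E" "(x, y) \<notin> E \<or> (y, x) \<notin> E"
  shows "acyclic_in E {x, y}"
proof (cases "(x, y) \<in> E")
  case False
  then show ?thesis
    using acyclic_in_insert_sink[of E "{y}" x] acyclic_in_singleton[of y E] assms(1)
    by (auto simp: irrefl_def)
next
  case True
  then have "acyclic_in E (insert y {x})"
    using acyclic_in_insert_sink[of E "{x}" y] acyclic_in_singleton[of x E] assms
    by (auto simp: irrefl_def)
  then show ?thesis by (simp add: insert_commute)
qed

text \<open>A directed cycle using vertices of both differences would have to pass through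
  \<open>x\<close> twice.\<close>

lemma acyclic_in_glue_at:
  assumes A: "acyclic_in E A" and B: "acyclic_in E B" and int: "A \<inter> B \<subseteq> {x}"
    and no: "\<And>a b. a \<in> A - B \<Longrightarrow> b \<in> B - A \<Longrightarrow> (a, b) \<notin> E \<and> (b, a) \<notin> E"
  shows "acyclic_in E (A \<union> B)"
proof -
  have no_cycle: "(a, a) \<notin> (Restr E (A \<union> B))\<^sup>+"
    if B: "acyclic_in E B" and A: "acyclic_in E A" and int: "A \<inter> B \<subseteq> {x}"
      and no: "\<And>a b. a \<in> A - B \<Longrightarrow> b \<in> B - A \<Longrightarrow> (a, b) \<notin> E \<and> (b, a) \<notin> E"
      and a: "a \<in> A"
    for A B a
  proof
    \<comment> \<open>The second alternative records that the walk has left \<open>A\<close> at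
      \<open>x\<close>. It could return only at \<open>x\<close>, which would close a cycle inside
      \<open>B\<close>.\<close>
    have *: "b \<in> A \<and> (a, b) \<in> (Restr E A)\<^sup>+ \<or> b \<in> B - A \<and> (x, b) \<in> (Restr E B)\<^sup>+"
      if "(a, b) \<in> (Restr E (A \<union> B))\<^sup>+" for b
      using that
    proof (induction rule: trancl_induct)
      case (base y)
      show ?case
      proof (cases "y \<in> A")
        case True
        with base a show ?thesis by (auto intro: r_into_trancl)
      next
        case False
        with base have y: "y \<in> B" "(a, y) \<in> E" by auto
        with no[of a y] False a have "a \<in> B" by auto
        with int a have "a = x" by auto
        with y \<open>a \<in> B\<close> False show ?thesis by (auto intro: r_into_trancl)
      qed
    next
      case (step y z)
      from step.hyps have yz: "(y, z) \<in> E" "z \<in> A \<union> B" by auto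
      from step.IH show ?case
      proof
        assume y: "y \<in> A \<and> (a, y) \<in> (Restr E A)\<^sup>+"
        show ?thesis
        proof (cases "z \<in> A")
          case True
          with y yz have "(y, z) \<in> Restr E A" by auto
          with y True show ?thesis by (meson trancl_into_trancl)
        next
          case False
          with no[of y z] y yz have "y \<in> B" by auto
          with int y have "y = x" by auto
          with yz False \<open>y \<in> B\<close> show ?thesis by (auto intro: r_into_trancl)
        qed
      next
        assume y: "y \<in> B - A \<and> (x, y) \<in> (Restr E B)\<^sup>+"
        with no[of z y] yz have "z \<in> B" by auto
        with y yz have "(y, z) \<in> Restr E B" by auto
        with y have xz: "(x, z) \<in> (Restr E B)\<^sup>+" by (meson trancl_into_trancl)
        have "z \<notin> A"
        proof
          assume "z \<in> A"
          with \<open>z \<in> B\<close> int have "z = x" by auto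
          with xz B show False by (auto simp: acyclic_in_def acyclic_def)
        qed
        with xz \<open>z \<in> B\<close> show ?thesis by auto
      qed
    qed
    assume "(a, a) \<in> (Restr E (A \<union> B))\<^sup>+"
    from *[OF this] a A show False by (auto simp: acyclic_in_def acyclic_def)
  qed
  show ?thesis
    unfolding acyclic_in_def
  proof (rule acyclicI, rule allI, rule notI)
    fix a assume cyc: "(a, a) \<in> (Restr E (A \<union> B))\<^sup>+"
    then have "a \<in> A \<union> B" by (auto dest: tranclD)
    then show False
    proof
      assume "a \<in> A"
      with no_cycle[OF B A int no] cyc show False by blast
    next
      assume "a \<in> B"
      with no_cycle[OF A B, of a] int no cyc show False by (auto simp: Int_commute Un_commute)
    qed
  qed
qed

section \<open>Extending and renaming colourings; degrees and cliques in critical sets\<close>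

lemma colouring_mono: "colouring n E V f \<Longrightarrow> W \<subseteq> V \<Longrightarrow> colouring n E W f"
  unfolding colouring_def by (blast intro: acyclic_in_mono)

lemma colouring_converse [simp]: "colouring n (E\<inverse>) V f = colouring n E V f"
  by (simp add: colouring_def)

lemma vcritical_converse [simp]: "vcritical n (E\<inverse>) V = vcritical n E V"
  by (simp add: vcritical_def)

text \<open>The new vertex is a sink in its colour class, hence lies on no cycle there.\<close>

lemma colouring_insert:
  assumes f: "colouring n E S f" and u: "u \<notin> S" "(u, u) \<notin> E" and c: "c < n"
    and free: "c \<notin> f ` (E `` {u} \<inter> S)"
  shows "colouring n E (insert u S) (f(u := c))"
  unfolding colouring_def
proof (intro conjI ballI allI)
  fix v assume "v \<in> insert u S"
  then show "(f(u := c)) v < n" using f c by (auto simp: colouring_def)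
next
  fix i
  have acyc: "acyclic_in E {v \<in> S. f v = i}" using f by (auto simp: colouring_def)
  show "acyclic_in E {v \<in> insert u S. (f(u := c)) v = i}"
  proof (cases "i = c")
    case True
    have "{v \<in> insert u S. (f(u := c)) v = i} = insert u {v \<in> S. f v = i}"
      using True u(1) by auto
    moreover have "acyclic_in E (insert u {v \<in> S. f v = i})"
      using acyc u(2) free True by (intro acyclic_in_insert_sink) auto
    ultimately show ?thesis by simp
  next
    case False
    then have "{v \<in> insert u S. (f(u := c)) v = i} = {v \<in> S. f v = i}"
      using u(1) by auto
    with acyc show ?thesis by simp
  qed
qed

lemma colouring_insert_few_colours:
  assumes f: "colouring n E S f" and u: "u \<notin> S" "(u, u) \<notin> E"
    and fin: "finite S" and few: "card (f ` (E `` {u} \<inter> S)) < n"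
  shows "\<exists>c<n. colouring n E (insert u S) (f(u := c))"
proof -
  have "\<exists>c. c \<in> {..<n} - f ` (E `` {u} \<inter> S)"
  proof (rule ccontr)
    assume "\<not> ?thesis"
    then have "{..<n} \<subseteq> f ` (E `` {u} \<inter> S)" by auto
    then have "card {..<n} \<le> card (f ` (E `` {u} \<inter> S))"
      using fin by (intro card_mono) auto
    with few show False by simp
  qed
  then show ?thesis using colouring_insert[OF f u] by auto
qed

lemma colouring_permute:
  assumes f: "colouring n E V f" and p: "inj p" "\<And>i. i < n \<Longrightarrow> p i < n"
  shows "colouring n E V (p \<circ> f)"
  unfolding colouring_def
proof (intro conjI ballI allI)
  fix i
  show "acyclic_in E {v \<in> V. (p \<circ> f) v = i}"
  proof (cases "i \<in> range p")
    case True
    then obtain j where "i = p j" by auto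
    then have "{v \<in> V. (p \<circ> f) v = i} = {v \<in> V. f v = j}"
      using p(1) by (auto simp: inj_eq)
    then show ?thesis using f by (simp add: colouring_def)
  next
    case False
    then have "{v \<in> V. (p \<circ> f) v = i} = {}" by auto
    then show ?thesis by (simp only: acyclic_in_empty)
  qed
qed (use f p in \<open>auto simp: colouring_def\<close>)

lemma vcritical_subset:
  assumes "vcritical n E V" "W \<subset> V"
  shows "\<exists>f. colouring n E W f"
proof -
  obtain v where "v \<in> V" "W \<subseteq> V - {v}" using assms(2) by auto
  then show ?thesis using assms(1) unfolding vcritical_def by (meson colouring_mono)
qed

text \<open>With fewer than \<open>n\<close> out-neighbours some colour is missing among them, and a
  colouring of \<open>V - {v}\<close> extends to \<open>v\<close>.\<close>

lemma vcritical_outdeg: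
  assumes crit: "vcritical n E V" and irr: "irrefl E" and v: "v \<in> V"
  shows "n \<le> outdeg E V v"
proof (rule ccontr)
  assume "\<not> ?thesis"
  moreover obtain f where f: "colouring n E (V - {v}) f"
    using crit v by (auto simp: vcritical_def)
  moreover have fin: "finite V" using crit by (simp add: vcritical_def)
  moreover have "card (f ` (E `` {v} \<inter> (V - {v}))) \<le> outdeg E V v"
    using fin by (intro order_trans[OF card_image_le] card_mono) auto
  ultimately have "\<exists>c<n. colouring n E (insert v (V - {v})) (f(v := c))"
    using irr by (intro colouring_insert_few_colours) (auto simp: irrefl_def)
  then show False using crit v by (auto simp: vcritical_def insert_absorb)
qed

lemma ex_vcritical_subset:
  assumes "finite V" "\<not> (\<exists>f. colouring n E V f)"
  shows "\<exists>W\<subseteq>V. vcritical n E W"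
  using assms
proof (induction V rule: finite_psubset_induct)
  case (psubset V)
  show ?case
  proof (cases "vcritical n E V")
    case False
    then obtain v where "v \<in> V" "\<not> (\<exists>f. colouring n E (V - {v}) f)"
      using psubset by (auto simp: vcritical_def)
    with psubset.IH[of "V - {v}"] show ?thesis by blast
  qed auto
qed

lemma card_Restr:
  assumes "finite V"
  shows "card (Restr E V) = (\<Sum>v\<in>V. outdeg E V v)"
proof -
  have "Restr E V = (SIGMA v:V. E `` {v} \<inter> V)" by auto
  then show ?thesis using assms by simp
qed

text \<open>By pigeonhole two vertices share a colour, and their digon is a cycle.\<close>

lemma clique_not_colourable:
  assumes "clique E Q" "n < card Q"
  shows "\<not> colouring n E Q f"
proof
  assume f: "colouring n E Q f"
  have "f ` Q \<subseteq> {..<n}" using f by (auto simp: colouring_def)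
  then have "card (f ` Q) \<le> n" by (metis card_lessThan card_mono finite_lessThan)
  then have "\<not> inj_on f Q" using assms(2) card_image by fastforce
  then obtain u v where uv: "u \<in> Q" "v \<in> Q" "u \<noteq> v" "f u = f v" by (auto simp: inj_on_def)
  then have "(u, v) \<in> Restr E {w \<in> Q. f w = f u}" "(v, u) \<in> Restr E {w \<in> Q. f w = f u}"
    using assms(1) by (auto simp: clique_def)
  then have "(u, u) \<in> (Restr E {w \<in> Q. f w = f u})\<^sup>+" by (meson r_into_trancl trancl_into_trancl)
  then show False using f by (auto simp: colouring_def acyclic_in_def acyclic_def)
qed

lemma vcritical_clique_eq:
  assumes "vcritical n E V" "clique E Q" "n < card Q" "Q \<subseteq> V"
  shows "Q = V"
  using vcritical_subset[OF assms(1), of Q] clique_not_colourable[OF assms(2,3)] assms(4) by blast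

subsection \<open>Brooks' theorem for digraphs\<close>

text \<open>The colours of \<open>g\<close> are renamed to agree with \<open>f\<close> at
  \<open>x\<close> and \<open>y\<close>. As these two colours differ, each class contains at most
  one of \<open>x\<close> and \<open>y\<close>, and its two halves are glued at a single
  vertex.\<close>

lemma colouring_glue_at_two:
  assumes f: "colouring n E (A \<union> {x, y}) f" and g: "colouring n E (B \<union> {x, y}) g"
    and ne: "f x \<noteq> f y" "g x \<noteq> g y" and disj: "A \<inter> B = {}" "x \<notin> A \<union> B" "y \<notin> A \<union> B"
    and no: "\<And>a b. a \<in> A \<Longrightarrow> b \<in> B \<Longrightarrow> (a, b) \<notin> E \<and> (b, a) \<notin> E"
  shows "\<exists>h. colouring n E (A \<union> B \<union> {x, y}) h"
proof -
  define p where "p = transpose (g x) (f x)"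
  \<comment> \<open>\<open>q\<close> corrects the colour of \<open>y\<close> and fixes
    \<open>f x\<close>, because neither \<open>p (g y)\<close> nor \<open>f y\<close> equals
    \<open>f x\<close>.\<close>
  define q where "q = transpose (p (g y)) (f y)"
  have lt: "f x < n" "f y < n" "g x < n" "g y < n" using f g by (auto simp: colouring_def)
  have p_lt: "p i < n" if "i < n" for i using lt that by (auto simp: p_def transpose_def)
  then have q_lt: "q i < n" if "i < n" for i using lt that by (auto simp: q_def transpose_def)
  define g' where "g' = (q \<circ> p) \<circ> g"
  have g': "colouring n E (B \<union> {x, y}) g'"
    unfolding g'_def using g p_lt q_lt
    by (intro colouring_permute) (auto intro!: inj_compose simp: p_def q_def inj_transpose)
  have p_gx: "p (g x) = f x" by (simp add: p_def)
  then have "p (g y) \<noteq> f x" using ne(2) by (metis p_def transpose_involutory)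
  then have g'_eq: "g' x = f x" "g' y = f y"
    using ne p_gx by (auto simp: g'_def q_def transpose_def)
  define h where "h v = (if v \<in> B then g' v else f v)" for v
  have "colouring n E (A \<union> B \<union> {x, y}) h"
    unfolding colouring_def
  proof (intro conjI ballI allI)
    fix v assume "v \<in> A \<union> B \<union> {x, y}"
    then show "h v < n" using f g' by (auto simp: h_def colouring_def)
  next
    fix i
    let ?S = "{v \<in> A \<union> {x, y}. f v = i}" and ?T = "{v \<in> B \<union> {x, y}. g' v = i}"
    have "acyclic_in E (?S \<union> ?T)"
    proof (rule acyclic_in_glue_at)
      show "acyclic_in E ?S" "acyclic_in E ?T" using f g' by (simp_all add: colouring_def)
      show "?S \<inter> ?T \<subseteq> {if f x = i then x else y}" using disj ne g'_eq by auto
      show "(a, b) \<notin> E \<and> (b, a) \<notin> E" if "a \<in> ?S - ?T" "b \<in> ?T - ?S" for a b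
        using that no[of a b] g'_eq by auto
    qed
    moreover have "{v \<in> A \<union> B \<union> {x, y}. h v = i} = ?S \<union> ?T"
      using disj g'_eq by (auto simp: h_def)
    ultimately show "acyclic_in E {v \<in> A \<union> B \<union> {x, y}. h v = i}" by simp
  qed
  then show ?thesis by blast
qed

lemma colouring_glue_closed:
  assumes f: "colouring n E A f" and g: "colouring n E B g" and disj: "A \<inter> B = {}"
    and no: "\<And>a b. a \<in> A \<Longrightarrow> b \<in> B \<Longrightarrow> f a = g b \<Longrightarrow> (a, b) \<notin> E"
  shows "\<exists>h. colouring n E (A \<union> B) h"
proof -
  define h where "h v = (if v \<in> A then f v else g v)" for v
  have "colouring n E (A \<union> B) h"
    unfolding colouring_def
  proof (intro conjI ballI allI)
    fix v assume "v \<in> A \<union> B"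
    then show "h v < n" using f g by (auto simp: h_def colouring_def)
  next
    fix i
    have "acyclic_in E ({v \<in> A. f v = i} \<union> {v \<in> B. g v = i})"
      using f g no by (intro acyclic_in_closed_Un) (auto simp: colouring_def)
    moreover have "{v \<in> A \<union> B. h v = i} = {v \<in> A. f v = i} \<union> {v \<in> B. g v = i}"
      using disj by (auto simp: h_def)
    ultimately show "acyclic_in E {v \<in> A \<union> B. h v = i}" by simp
  qed
  then show ?thesis by blast
qed

text \<open>Any colour other than \<open>f x\<close> missing among the out-neighbours of
  \<open>x\<close> in \<open>A\<close> could be given to \<open>x\<close>, which would separate it
  from \<open>y\<close>.\<close>

lemma outdeg_if_colour_forced:
  assumes f: "colouring n E (A \<union> {x, y}) f" and xy: "f x = f y" "x \<noteq> y" "x \<notin> A" "y \<notin> A"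
    and forced: "\<And>g. colouring n E (A \<union> {x, y}) g \<Longrightarrow> g x = g y"
    and irr: "irrefl E" and fin: "finite A"
  shows "n - 1 \<le> outdeg E A x"
proof -
  have "{..<n} - {f x} \<subseteq> f ` (E `` {x} \<inter> A)"
  proof
    fix c assume c: "c \<in> {..<n} - {f x}"
    show "c \<in> f ` (E `` {x} \<inter> A)"
    proof (rule ccontr)
      assume n: "c \<notin> f ` (E `` {x} \<inter> A)"
      have "colouring n E (insert x (A \<union> {y})) (f(x := c))"
      proof (rule colouring_insert)
        show "colouring n E (A \<union> {y}) f" using f by (rule colouring_mono) auto
      qed (use xy irr c n in \<open>auto simp: irrefl_def\<close>)
      moreover have "insert x (A \<union> {y}) = A \<union> {x, y}" by auto
      ultimately have "(f(x := c)) x = (f(x := c)) y" using forced by metis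
      then show False using c xy by auto
    qed
  qed
  then have "card ({..<n} - {f x}) \<le> card (f ` (E `` {x} \<inter> A))"
    using fin by (intro card_mono) auto
  moreover have "card (f ` (E `` {x} \<inter> A)) \<le> outdeg E A x"
    using fin by (intro card_image_le) auto
  moreover have "f x < n" using f by (auto simp: colouring_def)
  ultimately show ?thesis by simp
qed

text \<open>
  Colourings of the two sides of a cut \<open>{x, y}\<close> can be glued unless one side forces equal colours on \<open>x\<close>
  and \<open>y\<close>. That side then uses up all but one out-neighbour of each of them, so that on the other side
  \<open>x\<close> and \<open>y\<close> can be given a common colour which none of their out-neighbours has.
\<close>

lemma no_two_vertex_cut:
  assumes crit: "vcritical n E V" and irr: "irrefl E" and n: "3 \<le> n"
    and deg: "\<And>v. v \<in> V \<Longrightarrow> outdeg E V v = n"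
    and V: "V = A \<union> B \<union> {x, y}" and ne: "A \<noteq> {}" "B \<noteq> {}" "x \<noteq> y"
    and disj: "A \<inter> B = {}" "x \<notin> A \<union> B" "y \<notin> A \<union> B"
    and no: "\<And>a b. a \<in> A \<Longrightarrow> b \<in> B \<Longrightarrow> (a, b) \<notin> E \<and> (b, a) \<notin> E"
  shows False
proof -
  have fin: "finite V" using crit by (simp add: vcritical_def)
  have not_col: "\<not> colouring n E V h" for h using crit by (auto simp: vcritical_def)
  \<comment> \<open>The two sides are quantified anew because the argument is applied with either
    side as the forcing one.\<close>
  have side: False
    if f: "colouring n E (A \<union> {x, y}) f" and g: "colouring n E (B \<union> {x, y}) g"
      and V: "V = A \<union> B \<union> {x, y}" and disj: "A \<inter> B = {}" "x \<notin> A \<union> B" "y \<notin> A \<union> B"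
      and no: "\<And>a b. a \<in> A \<Longrightarrow> b \<in> B \<Longrightarrow> (a, b) \<notin> E \<and> (b, a) \<notin> E"
      and forced: "\<And>f. colouring n E (A \<union> {x, y}) f \<Longrightarrow> f x = f y"
    for A B f g
  proof -
    have finAB: "finite A" "finite B" using fin V by auto
    have split: "outdeg E B v \<le> 1" if "v \<in> {x, y}" "n - 1 \<le> outdeg E A v" for v
    proof -
      have "outdeg E A v + outdeg E B v = card (E `` {v} \<inter> A \<union> E `` {v} \<inter> B)"
        using finAB disj by (intro card_Un_disjoint[symmetric]) auto
      also have "\<dots> \<le> outdeg E V v" using fin V by (intro card_mono) auto
      also have "\<dots> = n" using deg V that by auto
      finally show ?thesis using that n by auto
    qed
    have eq: "f x = f y" using forced f by blast
    have x: "outdeg E B x \<le> 1"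
      using outdeg_if_colour_forced[OF f eq ne(3) _ _ forced irr finAB(1)] disj split by auto
    have f': "colouring n E (A \<union> {y, x}) f" using f by (simp add: insert_commute)
    have y: "outdeg E B y \<le> 1"
    proof -
      have "g y = g x" if "colouring n E (A \<union> {y, x}) g" for g
        using forced[of g] that by (simp add: insert_commute)
      from outdeg_if_colour_forced[OF f' eq[symmetric] _ _ _ this irr finAB(1)]
      show ?thesis using disj split ne by auto
    qed
    \<comment> \<open>At most two vertices in total, so with at least three colours some colour
      avoids them all.\<close>
    let ?N = "E `` {x} \<inter> B \<union> E `` {y} \<inter> B"
    have "card (g ` ?N) \<le> card ?N" using finAB by (intro card_image_le) auto
    also have "\<dots> \<le> outdeg E B x + outdeg E B y" by (rule card_Un_le)
    also have "\<dots> < n" using x y n by simp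
    finally have "\<exists>c. c \<in> {..<n} - g ` ?N"
      using finAB card_mono[of "g ` ?N" "{..<n}"] by fastforce
    then obtain c where c: "c < n" "c \<notin> g ` ?N" by auto
    define p where "p = transpose (f x) c"
    have "f x < n" using f by (auto simp: colouring_def)
    then have pf: "colouring n E (A \<union> {x, y}) (p \<circ> f)"
      using f c by (intro colouring_permute) (auto simp: p_def transpose_def inj_transpose)
    have gB: "colouring n E B g" using g by (rule colouring_mono) auto
    have "\<exists>h. colouring n E ((A \<union> {x, y}) \<union> B) h"
    proof (rule colouring_glue_closed[OF pf gB])
      fix a b assume ab: "a \<in> A \<union> {x, y}" "b \<in> B" "(p \<circ> f) a = g b"
      show "(a, b) \<notin> E"
      proof (cases "a \<in> A")
        case False
        with ab(1) have axy: "a \<in> {x, y}" by simp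
        then have "f a = f x" using eq by auto
        with ab(3) have "g b = c" by (simp add: p_def)
        show ?thesis
        proof
          assume "(a, b) \<in> E"
          with axy ab(2) have "b \<in> ?N" by auto
          with \<open>g b = c\<close> c(2) show False by (metis imageI)
        qed
      qed (use no ab in auto)
    qed (use disj in auto)
    then show False using not_col V by (auto simp: Un_ac)
  qed
  obtain a b where "a \<in> A" "b \<in> B" using ne(1,2) by blast
  then have "b \<in> V - (A \<union> {x, y})" "a \<in> V - (B \<union> {x, y})" using V disj by blast+
  moreover have "A \<union> {x, y} \<subseteq> V" "B \<union> {x, y} \<subseteq> V" unfolding V by auto
  ultimately have ps: "A \<union> {x, y} \<subset> V" "B \<union> {x, y} \<subset> V" by blast+
  obtain f where f: "colouring n E (A \<union> {x, y}) f" using vcritical_subset[OF crit ps(1)] by blast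
  obtain g where g: "colouring n E (B \<union> {x, y}) g" using vcritical_subset[OF crit ps(2)] by blast
  have "\<exists>f. colouring n E (A \<union> {x, y}) f \<and> f x \<noteq> f y"
    using side[of A f B g, OF f g V disj no] by metis
  moreover have "\<exists>g. colouring n E (B \<union> {x, y}) g \<and> g x \<noteq> g y"
  proof (rule ccontr)
    assume forced: "\<not> ?thesis"
    show False
      by (rule side[of B g A f, OF g f]) (use forced V disj no in \<open>auto simp: Un_ac Int_commute\<close>)
  qed
  ultimately obtain f g where "colouring n E (A \<union> {x, y}) f" "f x \<noteq> f y"
    "colouring n E (B \<union> {x, y}) g" "g x \<noteq> g y" by blast
  from colouring_glue_at_two[OF this(1,3,2,4) disj no] not_col V show False by auto
qed

text \<open>Let \<open>T\<close> be the out-neighbourhood of \<open>v\<close>. Each vertex of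
  \<open>T\<close> has exactly one out-neighbour outside \<open>T\<close>. The one of
  \<open>a\<close>, called \<open>z\<close>, lies in a clique with \<open>T - {a}\<close>, so it is
  also the one of every other vertex of \<open>T\<close>; hence \<open>insert z T\<close> is a
  clique with \<open>n + 1\<close> vertices and exhausts \<open>V\<close>.\<close>

lemma clique_if_outneighbourhoods_cliques:
  assumes crit: "vcritical n E V" and irr: "irrefl E" and n: "3 \<le> n" and ne: "V \<noteq> {}"
    and deg: "\<And>v. v \<in> V \<Longrightarrow> outdeg E V v = n"
    and cl: "\<And>v. v \<in> V \<Longrightarrow> clique E (E `` {v} \<inter> V)"
  shows "clique E V \<and> card V = n + 1"
proof -
  have fin: "finite V" using crit by (simp add: vcritical_def)
  obtain v where v: "v \<in> V" using ne by auto
  define T where "T = E `` {v} \<inter> V"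
  have T: "card T = n" "clique E T" "T \<subseteq> V" "finite T" using deg cl v fin by (auto simp: T_def)
  have w: "\<exists>w. w \<in> V - T \<and> E `` {a} \<inter> V = insert w (T - {a})" if a: "a \<in> T" for a
  proof -
    have sub: "T - {a} \<subseteq> E `` {a} \<inter> V" using T a by (auto simp: clique_def)
    have "card ((E `` {a} \<inter> V) - (T - {a})) = n - (n - 1)"
      using sub deg[of a] T a fin by (subst card_Diff_subset) auto
    then have "card ((E `` {a} \<inter> V) - (T - {a})) = 1" using n by simp
    then obtain w where w: "(E `` {a} \<inter> V) - (T - {a}) = {w}" by (rule card_1_singletonE)
    have "w \<noteq> a" using w irr by (auto simp: irrefl_def)
    then show ?thesis using w sub by (intro exI[of _ w]) auto
  qed
  obtain a where a: "a \<in> T" using T n by fastforce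
  then obtain z where z: "z \<in> V - T" "E `` {a} \<inter> V = insert z (T - {a})" using w by blast
  have za: "(z, b) \<in> E" if "b \<in> T" "b \<noteq> a" for b
  proof -
    have "clique E (insert z (T - {a}))" using cl[of a] z a T by auto
    then show ?thesis using that z a by (auto simp: clique_def)
  qed
  have az: "(b, z) \<in> E" if "b \<in> T" for b
  proof (cases "b = a")
    case False
    have "clique E (insert z (T - {a}))" using cl[of a] z a T by auto
    then show ?thesis using that z a False by (auto simp: clique_def)
  qed (use z in auto)
  have common: "E `` {b} \<inter> V = insert z (T - {b})" if b: "b \<in> T" for b
  proof (cases "b = a")
    case False
    obtain z' where z': "z' \<in> V - T" "E `` {b} \<inter> V = insert z' (T - {b})" using w b by blast
    then have "z = z'" using az[OF b] z z' by auto
    with z' show ?thesis by simp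
  qed (use z in simp)
  have "card (T - {a}) = n - 1" using T a by simp
  then have "T - {a} \<noteq> {}" using n by (intro notI) simp
  then obtain b where b: "b \<in> T" "b \<noteq> a" by auto
  have "clique E (insert z (T - {b}))" using cl[of b] common[OF b(1)] b T by auto
  then have "(z, a) \<in> E" using a b z by (auto simp: clique_def)
  with za have "(z, b) \<in> E" if "b \<in> T" for b using that by auto
  moreover have "(b, z) \<in> E" if "b \<in> T" for b using common[OF that] by auto
  ultimately have Q: "clique E (insert z T)" using T(2) by (auto simp: clique_def)
  have card: "card (insert z T) = n + 1" using T z by simp
  have "insert z T = V" using T z card by (intro vcritical_clique_eq[OF crit Q]) auto
  with Q card show ?thesis by simp
qed


text \<open>The scheme is that of Lovasz: \<open>v\<close> has out-neighbours \<open>x\<close> and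
  \<open>y\<close> without an arc from \<open>x\<close> to \<open>y\<close>, which receive the same
  colour. The rest is connected, as there is no two-vertex cut, so it can be coloured greedily
  towards \<open>v\<close>, and \<open>v\<close> finally sees a repeated colour.\<close>

theorem directed_Brooks:
  assumes crit: "vcritical n E V" and irr: "irrefl E" and n: "3 \<le> n" and ne: "V \<noteq> {}"
    and outdeg: "\<And>v. v \<in> V \<Longrightarrow> outdeg E V v = n"
    and indeg: "\<And>v. v \<in> V \<Longrightarrow> outdeg (E\<inverse>) V v = n"
  shows "clique E V \<and> card V = n + 1"
proof (rule ccontr)
  assume "\<not> ?thesis"
  with clique_if_outneighbourhoods_cliques[OF crit irr n ne outdeg]
  obtain v where v: "v \<in> V" "\<not> clique E (E `` {v} \<inter> V)" by blast
  then obtain x y where xy: "x \<in> E `` {v} \<inter> V" "y \<in> E `` {v} \<inter> V" "x \<noteq> y" "(x, y) \<notin> E"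
    by (auto simp: clique_def)
  have fin: "finite V" using crit by (simp add: vcritical_def)
  define U where "U = V - {x, y}"
  define R where "R = Restr (E \<union> E\<inverse>) U"
  have vU: "v \<in> U" using v xy irr by (auto simp: U_def irrefl_def)
  have conn: "U \<subseteq> R\<^sup>* `` {v}"
  proof (rule ccontr)
    assume not_conn: "\<not> ?thesis"
    have AU: "R\<^sup>* `` {v} \<subseteq> U"
    proof
      fix b assume "b \<in> R\<^sup>* `` {v}"
      then have "(v, b) \<in> R\<^sup>*" by auto
      then show "b \<in> U" by (cases rule: rtranclE) (use vU in \<open>auto simp: R_def\<close>)
    qed
    show False
    proof (rule no_two_vertex_cut[OF crit irr n outdeg, of "R\<^sup>* `` {v}" "U - R\<^sup>* `` {v}" x y])
      fix a b assume a: "a \<in> R\<^sup>* `` {v}" and b: "b \<in> U - R\<^sup>* `` {v}"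
      have "(a, b) \<notin> R" using a b by (auto intro: rtrancl_into_rtrancl)
      then show "(a, b) \<notin> E \<and> (b, a) \<notin> E" using a b AU by (auto simp: R_def)
    qed (use not_conn AU xy in \<open>auto simp: U_def\<close>)
  qed
  \<comment> \<open>\<open>T\<close> collects the vertices coloured so far besides \<open>x\<close>
    and \<open>y\<close>; \<open>v\<close> is kept for last.\<close>
  define good where "good T \<longleftrightarrow> T \<subseteq> U - {v} \<and>
    (\<exists>f. colouring n E ({x, y} \<union> T) f \<and> f x = f y)" for T
  \<comment> \<open>The uncoloured neighbour \<open>w\<close> leaves at most \<open>n - 1\<close>
    coloured out-neighbours or in-neighbours of \<open>u\<close>. In the second case the colour is
    chosen in the reversed digraph, which has the same colourings.\<close>
  have good_insert: "good (insert u T)"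
    if T: "good T" and u: "u \<in> U - T" "u \<noteq> v" and w: "w \<in> U - T" "(u, w) \<in> E \<union> E\<inverse>" for T u w
  proof -
    obtain f where f: "colouring n E ({x, y} \<union> T) f" "f x = f y" and TU: "T \<subseteq> U - {v}"
      using T by (auto simp: good_def)
    have fT: "finite ({x, y} \<union> T)" using TU fin by (auto simp: U_def intro: finite_subset)
    have few: "card (f ` (F `` {u} \<inter> ({x, y} \<union> T))) < n"
      if F: "(u, w) \<in> F" "outdeg F V u = n" for F
    proof -
      have "card (f ` (F `` {u} \<inter> ({x, y} \<union> T))) \<le> card (F `` {u} \<inter> ({x, y} \<union> T))"
        using fT by (intro card_image_le) auto
      also have "\<dots> < outdeg F V u"
        using w F TU xy fin by (intro psubset_card_mono) (auto simp: U_def)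
      finally show ?thesis using F by simp
    qed
    have u': "u \<notin> {x, y} \<union> T" "u \<in> V" "(u, u) \<notin> E" "(u, u) \<notin> E\<inverse>"
      using u irr by (auto simp: U_def irrefl_def)
    have "\<exists>c<n. colouring n E (insert u ({x, y} \<union> T)) (f(u := c))"
    proof (cases "(u, w) \<in> E")
      case True
      with few[OF True outdeg] u' show ?thesis
        by (intro colouring_insert_few_colours[OF f(1) _ _ fT]) auto
    next
      case False
      with w have "(u, w) \<in> E\<inverse>" by auto
      have f': "colouring n (E\<inverse>) ({x, y} \<union> T) f" using f(1) by (simp only: colouring_converse)
      from few[OF \<open>(u, w) \<in> E\<inverse>\<close> indeg[OF u'(2)]]
      have "\<exists>c<n. colouring n (E\<inverse>) (insert u ({x, y} \<union> T)) (f(u := c))"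
        by (rule colouring_insert_few_colours[OF f' u'(1,4) fT])
      then show ?thesis by simp
    qed
    then obtain c where "colouring n E (insert u ({x, y} \<union> T)) (f(u := c))" by auto
    moreover have "(f(u := c)) x = (f(u := c)) y" using f u' by auto
    ultimately show ?thesis using TU u unfolding good_def by (auto simp: insert_commute)
  qed
  have good_mono: "good T'" if "good T" "T' \<subseteq> T" for T T'
    using that unfolding good_def by (meson colouring_mono order_trans subset_refl Un_mono)
  have good_card: "card T \<le> card V" if "good T" for T
    using that fin by (intro card_mono) (auto simp: good_def U_def)
  have "acyclic_in E {v \<in> {x, y}. 0 = i}" for i :: nat
    using xy(4) by (intro acyclic_in_mono[OF acyclic_in_pair[OF irr, of x y]]) auto
  then have "colouring n E ({x, y} \<union> {}) (\<lambda>_. 0)"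
    using n unfolding colouring_def Un_empty_right by fastforce
  then have "good {}" unfolding good_def by blast
  then obtain T0 where T0: "good T0" and max: "\<And>T. good T \<Longrightarrow> card T \<le> card T0"
    using ex_has_greatest_nat[of good "{}" card "card V + 1"] good_card by (auto simp: le_imp_less_Suc)
  (* An uncoloured vertex can swap roles with a coloured neighbour, so it could be moved along a
     path to the uncoloured vertex v; next to v it can be coloured, contradicting maximality. *)
  have covered: "u \<in> T" if "(v, u) \<in> R\<^sup>*" "u \<noteq> v" "good T" "card T = card T0" for u T
    using that
  proof (induction arbitrary: T rule: rtrancl_induct)
    case (step w u)
    have uw: "u \<in> U" "w \<in> U" "(u, w) \<in> E \<union> E\<inverse>" using step.hyps by (auto simp: R_def)
    have finT: "finite T" using step.prems fin by (auto simp: good_def U_def intro: finite_subset)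
    show ?case
    proof (rule ccontr)
      assume u: "u \<notin> T"
      show False
      proof (cases "w \<in> T")
        case False
        then have "good (insert u T)" using good_insert[of T u w] step.prems uw u by auto
        from max[OF this] show False using step.prems u finT by simp
      next
        case True
        have "w \<noteq> u" using True u by auto
        have "good (T - {w})" using step.prems(2) by (rule good_mono) auto
        then have "good (insert u (T - {w}))" using good_insert[of "T - {w}" u w] step.prems uw u by auto
        moreover have "card (insert u (T - {w})) = card T0"
          using True u finT step.prems(3) card_gt_0_iff[of T] by (auto simp: card_insert_if)
        moreover have "w \<noteq> v" using True step.prems by (auto simp: good_def)
        ultimately have "w \<in> insert u (T - {w})" using step.IH by blast
        with \<open>w \<noteq> u\<close> show False by simp
      qed
    qed
  qed simp
  have "U - {v} \<subseteq> T0" using covered[OF _ _ T0 refl] conn by auto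
  with T0 obtain f where f: "colouring n E ({x, y} \<union> (U - {v})) f" "f x = f y"
    by (auto simp: good_def dest!: subset_antisym)
  let ?N = "E `` {v} \<inter> ({x, y} \<union> (U - {v}))"
  have V: "insert v ({x, y} \<union> (U - {v})) = V" using vU xy by (auto simp: U_def)
  \<comment> \<open>Since \<open>x\<close> and \<open>y\<close> share a colour, dropping
    \<open>y\<close> loses no colour, and at most \<open>n - 1\<close> colours occur on the
    out-neighbours of \<open>v\<close>.\<close>
  have "f ` ?N = f ` (?N - {y})"
  proof
    show "f ` ?N \<subseteq> f ` (?N - {y})"
    proof
      fix c assume "c \<in> f ` ?N"
      then obtain u where u: "u \<in> ?N" "c = f u" by blast
      have "x \<in> ?N - {y}" using xy by auto
      with u f(2) show "c \<in> f ` (?N - {y})" by (cases "u = y") (metis imageI, blast)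
    qed
  qed auto
  then have "card (f ` ?N) \<le> card (?N - {y})"
    using fin card_image_le[of "?N - {y}" f] by (simp add: U_def)
  also have "\<dots> < outdeg E V v" using xy fin by (intro psubset_card_mono) (auto simp: U_def)
  also have "\<dots> = n" using outdeg v by simp
  finally have "\<exists>c<n. colouring n E (insert v ({x, y} \<union> (U - {v}))) (f(v := c))"
    using fin irr xy by (intro colouring_insert_few_colours[OF f(1)]) (auto simp: U_def irrefl_def)
  then show False using crit V by (auto simp: vcritical_def)
qed

subsection \<open>Acyclic transversals of the large cliques\<close>

text \<open>Greedy choice: a chosen \<open>u\<close> has at most one out-neighbour among the
  candidates of the other sets. Deleting it makes \<open>u\<close> a sink for everything chosen
  later and shrinks at most one other set. So at each stage at most one set, \<open>W0\<close>, may
  be down to a single candidate.\<close>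

lemma acyclic_transversal:
  assumes "finite F" and irr: "irrefl E" and X: "acyclic_in E X"
    and "\<And>W. W \<in> F \<Longrightarrow> finite (C W)"
    and "\<And>W u. W \<in> F \<Longrightarrow> u \<in> C W \<Longrightarrow> card (E `` {u} \<inter> (\<Union>W'\<in>F - {W}. C W')) \<le> 1"
    and "\<And>W u. W \<in> F \<Longrightarrow> u \<in> C W \<Longrightarrow> E `` {u} \<inter> X = {}"
    and "\<And>W W'. W \<in> F \<Longrightarrow> W' \<in> F \<Longrightarrow> W \<noteq> W' \<Longrightarrow> C W \<inter> C W' = {}"
    and "\<And>W. W \<in> F \<Longrightarrow> C W \<noteq> {}"
    and "\<And>W. W \<in> F \<Longrightarrow> W \<noteq> W0 \<Longrightarrow> 2 \<le> card (C W)"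
  shows "\<exists>I. X \<subseteq> I \<and> I \<subseteq> X \<union> (\<Union>W\<in>F. C W) \<and> acyclic_in E I \<and> (\<forall>W\<in>F. I \<inter> C W \<noteq> {})"
  using assms(1,4-)
proof (induction F arbitrary: C W0 rule: finite_psubset_induct)
  case (psubset F)
  show ?case
  proof (cases "F = {}")
    case True
    then show ?thesis using X by auto
  next
    case False
    \<comment> \<open>The set that may have only one candidate is served first, so all the remaining
      ones have two.\<close>
    then obtain W1 where W1: "W1 \<in> F" "W0 \<in> F \<Longrightarrow> W1 = W0" by blast
    then obtain u where u: "u \<in> C W1" using psubset.prems(5) by blast
    define C' where "C' W = C W - E `` {u}" for W
    let ?F = "F - {W1}"
    have one: "card (E `` {u} \<inter> (\<Union>W\<in>?F. C W)) \<le> 1" using psubset.prems(2) W1(1) u by blast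
    have fin: "finite (E `` {u} \<inter> (\<Union>W\<in>?F. C W))" using psubset.hyps psubset.prems(1) by auto
    have single: "p = q" if "p \<in> E `` {u} \<inter> (\<Union>W\<in>?F. C W)" "q \<in> E `` {u} \<inter> (\<Union>W\<in>?F. C W)" for p q
      using one fin that by (metis One_nat_def card_le_Suc0_iff_eq)
    \<comment> \<open>\<open>W2\<close> is the only set that may lose a candidate; it takes over the
      role of \<open>W0\<close> in the induction.\<close>
    obtain W2 where W2: "\<And>W. W \<in> ?F \<Longrightarrow> W \<noteq> W2 \<Longrightarrow> C' W = C W"
    proof (cases "E `` {u} \<inter> (\<Union>W\<in>?F. C W) = {}")
      case True
      then have "C' W = C W" if "W \<in> ?F" for W using that by (auto simp: C'_def)
      then show ?thesis using that by blast
    next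
      case False
      then obtain p W where p: "(u, p) \<in> E" "W \<in> ?F" "p \<in> C W" by auto
      show ?thesis
      proof (rule that[of W])
        fix W' assume W': "W' \<in> ?F" "W' \<noteq> W"
        then have "C W \<inter> C W' = {}" using psubset.prems(4)[of W W'] p by auto
        then have "q \<notin> E `` {u}" if "q \<in> C W'" for q using single[of p q] p W' that by auto
        then show "C' W' = C W'" by (auto simp: C'_def)
      qed
    qed
    have big: "2 \<le> card (C W)" if "W \<in> ?F" for W using psubset.prems(6)[of W] that W1 by auto
    have "\<exists>I. X \<subseteq> I \<and> I \<subseteq> X \<union> (\<Union>W\<in>?F. C' W) \<and> acyclic_in E I \<and> (\<forall>W\<in>?F. I \<inter> C' W \<noteq> {})"
    proof (rule psubset.IH[of ?F C' W2])
      show "?F \<subset> F" using W1 by auto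
      fix W assume W: "W \<in> ?F"
      show "finite (C' W)" using W psubset.prems(1) by (auto simp: C'_def)
      show "E `` {v} \<inter> X = {}" if "v \<in> C' W" for v
        using that W psubset.prems(3) by (auto simp: C'_def)
      show "card (E `` {v} \<inter> (\<Union>W'\<in>?F - {W}. C' W')) \<le> 1" if v: "v \<in> C' W" for v
      proof -
        have "card (E `` {v} \<inter> (\<Union>W'\<in>?F - {W}. C' W')) \<le> card (E `` {v} \<inter> (\<Union>W'\<in>F - {W}. C W'))"
          using psubset.hyps psubset.prems(1) by (intro card_mono) (auto simp: C'_def)
        also have "\<dots> \<le> 1" using psubset.prems(2) W v by (auto simp: C'_def)
        finally show ?thesis .
      qed
      show "C' W \<inter> C' W' = {}" if "W' \<in> ?F" "W \<noteq> W'" for W'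
        using psubset.prems(4)[of W W'] W that by (auto simp: C'_def)
      show "2 \<le> card (C' W)" if "W \<noteq> W2" using big W W2[OF W that] by simp
      show "C' W \<noteq> {}"
      proof
        assume "C' W = {}"
        then have sub: "C W \<subseteq> E `` {u} \<inter> (\<Union>W\<in>?F. C W)" using W by (auto simp: C'_def)
        from card_mono[OF fin this] one big[OF W] show False by simp
      qed
    qed
    then obtain I where I: "X \<subseteq> I" "I \<subseteq> X \<union> (\<Union>W\<in>?F. C' W)" "acyclic_in E I"
      "\<forall>W\<in>?F. I \<inter> C' W \<noteq> {}" by blast
    have "acyclic_in E (insert u I)"
    proof (rule acyclic_in_insert_sink[OF I(3)])
      show "(u, u) \<notin> E" using irr by (auto simp: irrefl_def)
      show "E `` {u} \<inter> I = {}" using I(2) psubset.prems(3)[OF W1(1) u] by (auto simp: C'_def)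
    qed
    moreover have "insert u I \<inter> C W \<noteq> {}" if "W \<in> F" for W
      using I(4) u that by (cases "W = W1") (auto simp: C'_def)
    moreover have "insert u I \<subseteq> X \<union> (\<Union>W\<in>F. C W)" using I(2) u W1(1) by (auto simp: C'_def)
    ultimately show ?thesis using I(1) by (intro exI[of _ "insert u I"]) auto
  qed
qed

text \<open>The situation of a counterexample in the inductive step: \<open>excess\<close> says that
  the arcs fall short of the bound, and \<open>missed\<close> that an acyclic set with a vertex of
  out-degree above \<open>n\<close> always leaves some bidirected \<open>K\<^sub>n\<close>
  untouched. The goal is that every out-degree then equals \<open>n\<close>.\<close>

locale low_excess =
  fixes n :: nat and E :: "'a rel" and V :: "'a set"
  assumes irr: "irrefl E" and crit: "vcritical n E V" and n: "4 \<le> n"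
    and no_big_clique: "\<And>Q. clique E Q \<Longrightarrow> Q \<subseteq> V \<Longrightarrow> card Q \<noteq> n + 1"
    and excess: "(\<Sum>v\<in>V. outdeg E V v - n) \<le> n - 3"
    and missed: "\<And>I x. I \<subseteq> V \<Longrightarrow> acyclic_in E I \<Longrightarrow> x \<in> I \<Longrightarrow> n < outdeg E V x \<Longrightarrow>
      \<exists>Q\<subseteq>V - I. clique E Q \<and> card Q = n"
begin

text \<open>On \<open>V\<close> the truncated subtraction is exact, since criticality makes all
  degrees at least \<open>n\<close>; the same holds for \<open>ie\<close>.\<close>

definition oe :: "'a \<Rightarrow> nat" where "oe v = outdeg E V v - n"
definition ie :: "'a \<Rightarrow> nat" where "ie v = outdeg (E\<inverse>) V v - n"

lemma fin: "finite V" using crit by (simp add: vcritical_def)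

lemma noloop: "(u, u) \<notin> E" using irr by (simp add: irrefl_def)

lemma finV: "S \<subseteq> V \<Longrightarrow> finite S" using fin by (rule rev_finite_subset)

lemma outdeg_eq: "v \<in> V \<Longrightarrow> outdeg E V v = n + oe v"
  using vcritical_outdeg[OF crit irr] by (simp add: oe_def)

lemma indeg_eq: "v \<in> V \<Longrightarrow> outdeg (E\<inverse>) V v = n + ie v"
  using vcritical_outdeg[of n "E\<inverse>" V v] crit irr by (simp add: ie_def irrefl_def)

lemma sum_oe: "S \<subseteq> V \<Longrightarrow> sum oe S \<le> n - 3"
  using sum_mono2[OF fin, of S oe] excess by (simp add: oe_def)

text \<open>Out-degrees and in-degrees both sum to the number of arcs, so the total excesses
  agree.\<close>

lemma sum_ie: assumes "S \<subseteq> V" shows "sum ie S \<le> n - 3"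
proof -
  have "card (Restr (E\<inverse>) V) = card ((Restr E V)\<inverse>)" by (rule arg_cong[of _ _ card]) auto
  also have "\<dots> = card (Restr E V)" by (rule card_inverse)
  finally have "(\<Sum>v\<in>V. n + ie v) = (\<Sum>v\<in>V. n + oe v)"
    using card_Restr[OF fin, of E] card_Restr[OF fin, of "E\<inverse>"] outdeg_eq indeg_eq
    by (metis (no_types, lifting) sum.cong)
  then have "sum ie V = sum oe V" by (simp add: sum.distrib)
  then show ?thesis using sum_mono2[OF fin assms, of ie] sum_oe[of V] by simp
qed

section \<open>Complete subdigraphs on \<open>n\<close> vertices and how they meet\<close>

definition K :: "'a set set" where "K = {Q. Q \<subseteq> V \<and> clique E Q \<and> card Q = n}"

lemma K_D: "Q \<in> K \<Longrightarrow> Q \<subseteq> V" "Q \<in> K \<Longrightarrow> clique E Q" "Q \<in> K \<Longrightarrow> card Q = n" "Q \<in> K \<Longrightarrow> finite Q"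
  using finV by (auto simp: K_def)

lemma card_le_outdeg_excess:
  assumes "v \<in> S" "S \<subseteq> V" "S - {v} \<subseteq> E `` {v}"
  shows "card S \<le> n + 1 + oe v"
proof -
  have "card (S - {v}) \<le> outdeg E V v" using assms fin by (intro card_mono) auto
  then show ?thesis using assms outdeg_eq[of v] finV by (auto simp: card_Diff_singleton_if)
qed

text \<open>If the intersection has \<open>i\<close> vertices, each is joined to the whole union of
  \<open>2 * n - i\<close> vertices and so has out-excess at least \<open>n - 1 - i\<close>. For
  \<open>1 \<le> i \<le> n - 2\<close> the product \<open>i * (n - 1 - i)\<close> exceeds
  \<open>n - 3\<close>.\<close>

lemma card_Int_cliques:
  assumes Q: "Q \<in> K" "Q' \<in> K" "Q \<noteq> Q'" "Q \<inter> Q' \<noteq> {}"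
  shows "card (Q \<inter> Q') = n - 1"
proof -
  let ?i = "card (Q \<inter> Q')"
  have f: "finite Q" "finite Q'" using Q K_D by auto
  have "?i > 0" using Q f by (simp add: card_gt_0_iff)
  have "?i \<noteq> n"
  proof
    assume "?i = n"
    then have "Q \<inter> Q' = Q" "Q \<inter> Q' = Q'"
      using K_D Q f by (metis card_subset_eq inf_le1, metis card_subset_eq inf_le2)
    then show False using Q by simp
  qed
  moreover have "?i \<le> n" using card_mono[OF f(1), of "Q \<inter> Q'"] K_D(3)[OF Q(1)] by auto
  ultimately have "?i < n" by simp
  have U: "card (Q \<union> Q') + ?i = 2 * n" using card_Un_Int[OF f] K_D Q by simp
  have "n - 1 - ?i \<le> oe v" if v: "v \<in> Q \<inter> Q'" for v
  proof -
    have "card (Q \<union> Q') \<le> n + 1 + oe v"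
      using v K_D(1,2)[OF Q(1)] K_D(1,2)[OF Q(2)] by (intro card_le_outdeg_excess) (auto simp: clique_def)
    then show ?thesis using U by simp
  qed
  then have "?i * (n - 1 - ?i) \<le> sum oe (Q \<inter> Q')" using sum_bounded_below[of "Q \<inter> Q'" "n - 1 - ?i" oe] by simp
  also have "\<dots> \<le> n - 3" using K_D(1)[OF Q(1)] by (intro sum_oe) auto
  finally have le: "?i * (n - 1 - ?i) \<le> n - 3" .
  show ?thesis
  proof (rule ccontr)
    assume "?i \<noteq> n - 1"
    \<comment> \<open>With \<open>a = i - 1\<close> and \<open>b = n - 2 - i\<close> the bound reads
      \<open>(a + 1) * (b + 1) \<le> a + b\<close>, which is impossible.\<close>
    then have ab: "?i = Suc (?i - 1)" "n - 1 - ?i = Suc (n - 2 - ?i)" "n - 3 = (?i - 1) + (n - 2 - ?i)"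
      using \<open>?i > 0\<close> \<open>?i < n\<close> by linarith+
    have "Suc (?i - 1) * Suc (n - 2 - ?i) \<le> (?i - 1) + (n - 2 - ?i)"
      using le unfolding ab(3) by (simp only: ab(1,2)[symmetric])
    then show False by simp
  qed
qed

lemma K_exchange:
  assumes Q: "Q \<in> K" "Q' \<in> K" "Q \<noteq> Q'" "Q \<inter> Q' \<noteq> {}"
  shows "\<exists>y z. y \<in> Q \<and> z \<notin> Q \<and> Q' = insert z (Q - {y})"
proof -
  have i: "card (Q \<inter> Q') = n - 1" using card_Int_cliques[OF Q] .
  have f: "finite Q" "finite Q'" using Q K_D by auto
  have "card (Q - Q') = n - (n - 1)" "card (Q' - Q) = n - (n - 1)"
    using card_Diff_subset_Int[of Q Q'] card_Diff_subset_Int[of Q' Q] i f K_D(3)[OF Q(1)] K_D(3)[OF Q(2)]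
    by (simp_all add: Int_commute[of Q'])
  then have one: "card (Q - Q') = 1" "card (Q' - Q) = 1" using n by simp_all
  obtain y where y: "Q - Q' = {y}" using one(1) by (rule card_1_singletonE)
  obtain z where z: "Q' - Q = {z}" using one(2) by (rule card_1_singletonE)
  note yz = y z
  have "Q' = insert z (Q - {y})"
  proof
    show "Q' \<subseteq> insert z (Q - {y})" using yz by fast
    show "insert z (Q - {y}) \<subseteq> Q'" using yz by fast
  qed
  moreover have "y \<in> Q" "z \<notin> Q" using yz by fast+
  ultimately show ?thesis by (intro exI[of _ y] exI[of _ z] conjI)
qed

lemma no_three_cliques:
  assumes Q: "Q \<in> K" "Q' \<in> K" "Q'' \<in> K" "Q \<noteq> Q'" "Q \<noteq> Q''" "Q' \<noteq> Q''"
    and ne: "Q \<inter> Q' \<noteq> {}" "Q \<inter> Q'' \<noteq> {}"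
  shows False
proof -
  obtain y z where y: "y \<in> Q" "z \<notin> Q" "Q' = insert z (Q - {y})" using K_exchange Q ne by meson
  obtain y' z' where y': "y' \<in> Q" "z' \<notin> Q" "Q'' = insert z' (Q - {y'})" using K_exchange Q ne by meson
  note D = K_D[OF Q(1)] K_D[OF Q(2)] K_D[OF Q(3)]
  show False
  proof (cases "z = z'")
    case True
    then have "y \<noteq> y'" using y y' Q by auto
    then have "clique E (insert z Q)" using D(2,6,10) True y y' unfolding clique_def by auto
    moreover have "insert z Q \<subseteq> V" "card (insert z Q) = n + 1" using D y by auto
    ultimately show False using no_big_clique by blast
  next
    case False
    have "1 \<le> oe v" if v: "v \<in> Q - {y, y'}" for v
    proof -
      have "card (insert z (insert z' Q)) \<le> n + 1 + oe v"
        using D v y y' by (intro card_le_outdeg_excess) (auto simp: clique_def)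
      then show ?thesis using D y y' False by simp
    qed
    then have "card (Q - {y, y'}) \<le> sum oe (Q - {y, y'})"
      using sum_bounded_below[of "Q - {y, y'}" 1 oe] by simp
    also have "\<dots> \<le> n - 3" using D by (intro sum_oe) auto
    finally have "card (Q - {y, y'}) \<le> n - 3" .
    moreover have "card Q - card {y, y'} \<le> card (Q - {y, y'})" by (intro diff_card_le_card_Diff) auto
    moreover have "card {y, y'} \<le> 2" by (simp add: card_insert_if)
    ultimately show False using D n by simp
  qed
qed

text \<open>
  A cluster is a bidirected \<open>K\<^sub>n\<close> that meets no other one, or the union of two that meet, which is a
  \<open>K\<^bsub>n+1\<^esub>\<close> minus one or both arcs of a digon. To hit every \<open>K\<^sub>n\<close> inside a cluster it suffices to pick
  one vertex of its core, or both vertices outside the core.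
\<close>

definition clusters :: "'a set set" where
  "clusters = (\<lambda>Q. \<Union>{Q' \<in> K. Q' \<inter> Q \<noteq> {}}) ` K"

definition core :: "'a set \<Rightarrow> 'a set" where
  "core W = {u \<in> W. \<forall>w \<in> W - {u}. (u, w) \<in> E \<and> (w, u) \<in> E}"

lemma cluster_cases:
  assumes "W \<in> clusters"
  obtains Q where "Q \<in> K" "W = Q" "\<And>Q'. Q' \<in> K \<Longrightarrow> Q' \<inter> W \<noteq> {} \<Longrightarrow> Q' = Q"
  | Q Q' where "Q \<in> K" "Q' \<in> K" "Q \<noteq> Q'" "Q \<inter> Q' \<noteq> {}" "W = Q \<union> Q'"
    "\<And>Q''. Q'' \<in> K \<Longrightarrow> Q'' \<inter> W \<noteq> {} \<Longrightarrow> Q'' = Q \<or> Q'' = Q'"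
proof -
  obtain Q where Q: "Q \<in> K" "W = \<Union>{Q' \<in> K. Q' \<inter> Q \<noteq> {}}" using assms by (auto simp: clusters_def)
  have "Q \<noteq> {}" using K_D(3)[OF Q(1)] n by auto
  show ?thesis
  proof (cases "\<exists>Q'\<in>K. Q' \<noteq> Q \<and> Q' \<inter> Q \<noteq> {}")
    case False
    then have "{Q' \<in> K. Q' \<inter> Q \<noteq> {}} = {Q}" using Q \<open>Q \<noteq> {}\<close> by auto
    then have "W = Q" using Q by simp
    then show ?thesis using that(1)[OF Q(1)] False by auto
  next
    case True
    then obtain Q' where Q': "Q' \<in> K" "Q' \<noteq> Q" "Q' \<inter> Q \<noteq> {}" by auto
    have only: "Q'' = Q \<or> Q'' = Q'" if "Q'' \<in> K" "Q'' \<inter> Q \<noteq> {} \<or> Q'' \<inter> Q' \<noteq> {}" for Q''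
      using no_three_cliques[of Q Q' Q''] no_three_cliques[of Q' Q Q''] Q Q' that by blast
    then have "{Q' \<in> K. Q' \<inter> Q \<noteq> {}} = {Q, Q'}" using Q Q' \<open>Q \<noteq> {}\<close> by auto
    then have "W = Q \<union> Q'" using Q by simp
    then show ?thesis using that(2)[of Q Q'] Q Q' only by blast
  qed
qed

lemma cluster_subset: "W \<in> clusters \<Longrightarrow> W \<subseteq> V" "W \<in> clusters \<Longrightarrow> finite W"
  using K_D by (auto elim!: cluster_cases)

text \<open>A cluster contains every member of \<open>K\<close> that meets it, so a common vertex
  forces inclusion in both directions.\<close>

lemma clusters_disjoint:
  assumes "W \<in> clusters" "W' \<in> clusters" "W \<noteq> W'"
  shows "W \<inter> W' = {}"
proof (rule ccontr)
  assume ne: "W \<inter> W' \<noteq> {}"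
  have *: "W = \<Union>{Q' \<in> K. Q' \<inter> W \<noteq> {}}" if "W \<in> clusters" for W
    using that
  proof (cases rule: cluster_cases)
    case (1 Q)
    then show ?thesis by auto
  next
    case (2 Q Q')
    then show ?thesis by blast
  qed
  have sub: "W \<subseteq> W'" if W: "W \<in> clusters" "W' \<in> clusters" "W \<inter> W' \<noteq> {}" for W W'
  proof -
    obtain p where p: "p \<in> W" "p \<in> W'" using W by auto
    obtain P where P: "P \<in> K" "p \<in> P" "P \<subseteq> W'" using *[OF W(2)] p by blast
    have meet: "Q \<subseteq> W'" if "Q \<in> K" "Q \<inter> W' \<noteq> {}" for Q using *[OF W(2)] that by blast
    from W(1) show ?thesis
    proof (cases rule: cluster_cases)
      case (1 Q)
      then show ?thesis using P p by blast
    next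
      case (2 Q Q')
      have "P \<inter> W \<noteq> {}" using P(2) p(1) by auto
      with 2(6)[OF P(1)] have "P = Q \<or> P = Q'" by simp
      then have "Q \<inter> W' \<noteq> {}" "Q' \<inter> W' \<noteq> {}" using 2(4) P(2,3) by auto
      with meet 2(1,2) show ?thesis unfolding 2(5) by simp
    qed
  qed
  from sub[of W W'] sub[of W' W] ne assms show False by blast
qed

lemma core_subset: "core W \<subseteq> W" by (auto simp: core_def)

lemma cluster_shape:
  assumes "W \<in> clusters"
  obtains "core W = W" "card W = n"
  | x y where "x \<noteq> y" "W - core W = {x, y}" "card (core W) = n - 1" "(x, y) \<notin> E \<or> (y, x) \<notin> E"
  using assms
proof (cases rule: cluster_cases)
  case (1 Q)
  have "core W = W" using K_D(2)[OF 1(1)] unfolding 1(2) core_def clique_def by auto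
  moreover have "card W = n" using K_D(3)[OF 1(1)] 1(2) by simp
  ultimately show ?thesis by (rule that(1))
next
  case (2 Q Q')
  obtain y z where yz: "y \<in> Q" "z \<notin> Q" "Q' = insert z (Q - {y})"
    using K_exchange[OF 2(1-4)] by blast
  have W: "W = insert z Q" unfolding 2(5) using yz by auto
  note D = K_D[OF 2(1)] K_D[OF 2(2)]
  have sub: "Q - {y} \<subseteq> core W" using D(2,6) yz unfolding core_def clique_def W by auto
  have nd: "(y, z) \<notin> E \<or> (z, y) \<notin> E"
  proof (rule ccontr)
    assume "\<not> ?thesis"
    then have "clique E (insert z Q)" using D(2,6) yz unfolding clique_def by auto
    moreover have "insert z Q \<subseteq> V" "card (insert z Q) = n + 1" using D yz by auto
    ultimately show False using no_big_clique by blast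
  qed
  have "y \<noteq> z" using yz by auto
  then have "y \<notin> core W" "z \<notin> core W" using nd yz unfolding core_def W by auto
  then have c: "core W = Q - {y}" using sub core_subset[of W] unfolding W by auto
  moreover have "W - core W = {y, z}" using c yz unfolding W by auto
  moreover have "card (core W) = n - 1" using c D yz by simp
  ultimately show ?thesis using that(2)[OF \<open>y \<noteq> z\<close>] nd by simp
qed

lemma card_cluster: "W \<in> clusters \<Longrightarrow> n \<le> card W"
proof (cases rule: cluster_shape, assumption)
  fix x y assume W: "W \<in> clusters" and xy: "x \<noteq> y" "W - core W = {x, y}" "card (core W) = n - 1"
  have "card (W - core W) = card W - card (core W)"
    using cluster_subset(2)[OF W] core_subset finite_subset by (intro card_Diff_subset) blast+
  then show ?thesis using xy by simp
qed auto

lemma cluster_hit: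
  assumes Q: "Q \<in> K"
    and hit: "\<And>W. W \<in> clusters \<Longrightarrow> core W \<inter> I \<noteq> {} \<or> W \<noteq> core W \<and> W - core W \<subseteq> I"
  shows "Q \<inter> I \<noteq> {}"
proof -
  have "Q \<noteq> {}" using K_D(3)[OF Q] n by auto
  define W where "W = \<Union>{Q' \<in> K. Q' \<inter> Q \<noteq> {}}"
  have W: "W \<in> clusters" "Q \<subseteq> W" using Q \<open>Q \<noteq> {}\<close> by (auto simp: clusters_def W_def)
  note D = K_D[OF Q]
  have core: "core W \<subseteq> Q"
  proof
    fix u assume u: "u \<in> core W"
    show "u \<in> Q"
    proof (rule ccontr)
      assume "u \<notin> Q"
      then have "clique E (insert u Q)" using u W D by (auto simp: clique_def core_def)
      moreover have "insert u Q \<subseteq> V" "card (insert u Q) = n + 1"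
        using D \<open>u \<notin> Q\<close> u core_subset[of W] cluster_subset(1)[OF W(1)] by auto
      ultimately show False using no_big_clique by blast
    qed
  qed
  from hit[OF W(1)] show ?thesis
  proof
    assume *: "W \<noteq> core W \<and> W - core W \<subseteq> I"
    from W(1) show ?thesis
    proof (cases rule: cluster_shape)
      case (2 x y)
      have "\<not> Q \<subseteq> core W"
        using 2 D card_mono[of "core W" Q] n core_subset[of W] cluster_subset(2)[OF W(1)]
        by (auto dest: finite_subset)
      then show ?thesis using * W(2) by blast
    qed (use * in auto)
  qed (use core in auto)
qed

text \<open>Without arcs into \<open>X\<close>, a chosen vertex can be added to an acyclic set
  containing \<open>X\<close> as a sink.\<close>

definition cand :: "'a set \<Rightarrow> 'a set \<Rightarrow> 'a set" where
  "cand X W = {u \<in> core W. oe u = 0 \<and> E `` {u} \<inter> X = {}}"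

text \<open>
  A vertex of the core with out-excess 0 has at most one out-neighbour outside its cluster; this makes
  the greedy choice in \<open>acyclic_transversal\<close> possible.
\<close>

lemma transversal_contradiction:
  assumes X: "X \<subseteq> V" "acyclic_in E X" and x: "x \<in> X" "0 < oe x" and U: "U \<subseteq> clusters"
    and hit: "\<And>W. W \<in> clusters - U \<Longrightarrow> core W \<inter> X \<noteq> {} \<or> W \<noteq> core W \<and> W - core W \<subseteq> X"
    and ne: "\<And>W. W \<in> U \<Longrightarrow> cand X W \<noteq> {}"
    and two: "\<And>W W'. W \<in> U \<Longrightarrow> W' \<in> U \<Longrightarrow> W \<noteq> W' \<Longrightarrow> 2 \<le> card (cand X W) \<or> 2 \<le> card (cand X W')"
  shows False
proof -
  have cand_sub: "cand X W \<subseteq> W" for W using core_subset by (auto simp: cand_def)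
  have "finite clusters"
    using cluster_subset(1) fin by (intro finite_subset[of clusters "Pow V"]) auto
  then have finU: "finite U" using U finite_subset by blast
  \<comment> \<open>The one cluster of \<open>U\<close> with fewer than two candidates, if there is
    one.\<close>
  obtain W0 where W0: "\<And>W. W \<in> U \<Longrightarrow> W \<noteq> W0 \<Longrightarrow> 2 \<le> card (cand X W)"
    using two by (cases "\<exists>W\<in>U. \<not> 2 \<le> card (cand X W)") blast+
  have "\<exists>I. X \<subseteq> I \<and> I \<subseteq> X \<union> (\<Union>W\<in>U. cand X W) \<and> acyclic_in E I \<and> (\<forall>W\<in>U. I \<inter> cand X W \<noteq> {})"
  proof (rule acyclic_transversal[OF finU irr X(2), where ?W0.0 = W0])
    fix W assume W: "W \<in> U"
    then have W': "W \<in> clusters" using U by blast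
    show "finite (cand X W)" using cand_sub cluster_subset(2)[OF W'] finite_subset by blast
    show "cand X W \<inter> cand X W' = {}" if "W' \<in> U" "W \<noteq> W'" for W'
      using clusters_disjoint[OF W', of W'] cand_sub U that by blast
    fix u assume u: "u \<in> cand X W"
    then show "E `` {u} \<inter> X = {}" by (simp add: cand_def)
    have uW: "u \<in> W" "u \<in> V" using u cand_sub cluster_subset(1)[OF W'] by auto
    have others: "(\<Union>W'\<in>U - {W}. cand X W') \<subseteq> V - W"
    proof
      fix v assume "v \<in> (\<Union>W'\<in>U - {W}. cand X W')"
      then obtain W2 where "W2 \<in> U" "W2 \<noteq> W" "v \<in> W2" using cand_sub by blast
      then show "v \<in> V - W" using clusters_disjoint[OF W', of W2] cluster_subset(1)[of W2] U by blast
    qed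
    have "card (E `` {u} \<inter> (\<Union>W'\<in>U - {W}. cand X W')) \<le> card (E `` {u} \<inter> V - (W - {u}))"
      using others fin by (intro card_mono) auto
    also have "\<dots> = outdeg E V u - card (W - {u})"
      using u cluster_subset[OF W'] by (intro card_Diff_subset) (auto simp: cand_def core_def)
    also have "\<dots> \<le> 1"
      using outdeg_eq[OF uW(2)] u card_cluster[OF W'] uW(1) by (simp add: cand_def)
    finally show "card (E `` {u} \<inter> (\<Union>W'\<in>U - {W}. cand X W')) \<le> 1" .
  qed (use ne W0 in auto)
  then obtain I where I: "X \<subseteq> I" "I \<subseteq> X \<union> (\<Union>W\<in>U. cand X W)" "acyclic_in E I"
    "\<forall>W\<in>U. I \<inter> cand X W \<noteq> {}" by blast
  have "(\<Union>W\<in>U. cand X W) \<subseteq> V" using cand_sub cluster_subset(1) U by blast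
  then have "I \<subseteq> V" using I(2) X(1) by blast
  moreover have "x \<in> I" "n < outdeg E V x" using x I(1) outdeg_eq[of x] X(1) by auto
  ultimately obtain Q where Q: "Q \<subseteq> V - I" "clique E Q" "card Q = n" using missed I(3) by blast
  then have "Q \<in> K" by (auto simp: K_def)
  moreover have "core W \<inter> I \<noteq> {} \<or> W \<noteq> core W \<and> W - core W \<subseteq> I" if "W \<in> clusters" for W
  proof (cases "W \<in> U")
    case True
    then show ?thesis using I(4) by (auto simp: cand_def)
  next
    case False
    then show ?thesis using hit[of W] that I(1) by blast
  qed
  ultimately have "Q \<inter> I \<noteq> {}" by (rule cluster_hit)
  then show False using Q by auto
qed

section \<open>Counting the arcs from a cluster to a vertex, and the candidates they rule
  out\<close>

definition arcs_into :: "'a \<Rightarrow> 'a set \<Rightarrow> nat" where "arcs_into x W = card (E\<inverse> `` {x} \<inter> W)"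

lemma arcs_into_own_cluster:
  assumes W: "W \<in> clusters" "x \<in> W"
  shows "n - 1 \<le> arcs_into x W"
  using W(1)
proof (cases rule: cluster_shape)
  case 1
  have "W - {x} \<subseteq> E\<inverse> `` {x} \<inter> W" using W(2) 1(1) by (auto simp: core_def)
  then have "card (W - {x}) \<le> arcs_into x W"
    unfolding arcs_into_def using cluster_subset(2)[OF W(1)] by (intro card_mono) auto
  then show ?thesis using 1(2) W(2) by simp
next
  case (2 y z)
  show ?thesis
  proof (cases "x \<in> core W")
    case True
    have "W - {x} \<subseteq> E\<inverse> `` {x} \<inter> W" using True by (auto simp: core_def)
    then have "card (W - {x}) \<le> arcs_into x W"
      unfolding arcs_into_def using cluster_subset(2)[OF W(1)] by (intro card_mono) auto
    then show ?thesis using card_cluster[OF W(1)] W(2) by simp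
  next
    case False
    have "core W \<subseteq> E\<inverse> `` {x} \<inter> W" using False W(2) by (auto simp: core_def)
    then have "card (core W) \<le> arcs_into x W"
      unfolding arcs_into_def using cluster_subset(2)[OF W(1)] by (intro card_mono) auto
    then show ?thesis using 2(3) by simp
  qed
qed

lemma sum_arcs_into:
  assumes S: "S \<subseteq> clusters" "finite S" and x: "x \<in> V"
  shows "(\<Sum>W\<in>S. arcs_into x W) \<le> n + ie x"
proof -
  have "(\<Sum>W\<in>S. arcs_into x W) = card (\<Union>W\<in>S. E\<inverse> `` {x} \<inter> W)"
    unfolding arcs_into_def using S cluster_subset(2) clusters_disjoint
    by (intro card_UN_disjoint[symmetric]) blast+
  also have "\<dots> \<le> outdeg (E\<inverse>) V x"
    using S(1) cluster_subset(1) fin by (intro card_mono) blast+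
  finally show ?thesis using indeg_eq[OF x] by simp
qed

lemma arcs_into_two:
  assumes "W \<in> clusters" "W' \<in> clusters" "W \<noteq> W'" "x \<in> V"
  shows "arcs_into x W + arcs_into x W' \<le> n + ie x"
  using sum_arcs_into[of "{W, W'}" x] assms by simp

lemma arcs_into_three:
  assumes "W \<in> clusters" "W' \<in> clusters" "W'' \<in> clusters" "W \<noteq> W'" "W \<noteq> W''" "W' \<noteq> W''" "x \<in> V"
  shows "arcs_into x W + (arcs_into x W' + arcs_into x W'') \<le> n + ie x"
  using sum_arcs_into[of "{W, W', W''}" x] assms by simp

text \<open>In a single \<open>K\<^sub>n\<close>, a vertex that is no candidate has positive
  out-excess or sends an arc to \<open>X\<close>. In a union of two, a core vertex of excess 0 has
  all its \<open>n\<close> out-neighbours in \<open>W\<close>, and at most \<open>n - 3\<close> of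
  the \<open>n - 1\<close> core vertices have larger excess.\<close>

lemma card_cand:
  assumes W: "W \<in> clusters" and X: "W \<inter> X = {}" "X \<subseteq> V"
  shows "2 \<le> card (cand X W) \<or>
    core W = W \<and> card W = n \<and> n \<le> card (cand X W) + sum oe W + (\<Sum>x\<in>X. arcs_into x W)"
  using W
proof (cases rule: cluster_shape)
  case 1
  have finW: "finite W" using cluster_subset(2)[OF W] .
  have finX: "finite X" using finV[OF X(2)] .
  have "W \<subseteq> cand X W \<union> ({u \<in> W. 1 \<le> oe u} \<union> (\<Union>x\<in>X. E\<inverse> `` {x} \<inter> W))"
    using 1 by (auto simp: cand_def)
  then have "card W \<le> card (cand X W \<union> ({u \<in> W. 1 \<le> oe u} \<union> (\<Union>x\<in>X. E\<inverse> `` {x} \<inter> W)))"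
    using finW finX core_subset[of W] finite_subset[OF _ finW]
    by (intro card_mono) (auto simp: cand_def)
  also have "\<dots> \<le> card (cand X W) + card ({u \<in> W. 1 \<le> oe u} \<union> (\<Union>x\<in>X. E\<inverse> `` {x} \<inter> W))"
    by (rule card_Un_le)
  also have "\<dots> \<le> card (cand X W) + (card {u \<in> W. 1 \<le> oe u} + card (\<Union>x\<in>X. E\<inverse> `` {x} \<inter> W))"
    by (intro add_left_mono card_Un_le)
  also have "card (\<Union>x\<in>X. E\<inverse> `` {x} \<inter> W) \<le> (\<Sum>x\<in>X. arcs_into x W)"
    unfolding arcs_into_def using finX by (rule card_UN_le)
  also have "card {u \<in> W. 1 \<le> oe u} \<le> sum oe {u \<in> W. 1 \<le> oe u}"
    using sum_bounded_below[of "{u \<in> W. 1 \<le> oe u}" 1 oe] by simp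
  also have "\<dots> \<le> sum oe W" using finW by (intro sum_mono2) auto
  finally show ?thesis using 1 by simp
next
  case (2 y z)
  have finW: "finite W" and WV: "W \<subseteq> V" using cluster_subset[OF W] by auto
  have finc: "finite (core W)" using finW core_subset finite_subset by blast
  have y: "y \<in> W - core W" "z \<in> W - core W" using 2 by auto
  have cW: "card W = n + 1"
  proof -
    have "card (W - core W) = card W - card (core W)" using finc core_subset by (rule card_Diff_subset)
    then have "card W - card (core W) = 2" using 2(1,2) by simp
    then show ?thesis using 2(3) n by linarith
  qed
  have "E `` {u} \<inter> V = W - {u}" if u: "u \<in> core W" "oe u = 0" for u
  proof (rule sym, rule card_subset_eq)
    have uW: "u \<in> W" using u core_subset by blast
    show "W - {u} \<subseteq> E `` {u} \<inter> V" using u WV by (auto simp: core_def)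
    show "card (W - {u}) = outdeg E V u" using outdeg_eq[of u] u uW WV cW finW by auto
  qed (use fin in auto)
  then have "core W \<subseteq> cand X W \<union> {u \<in> core W. 1 \<le> oe u}"
    using X by (fastforce simp: cand_def)
  then have "card (core W) \<le> card (cand X W \<union> {u \<in> core W. 1 \<le> oe u})"
    using finc by (intro card_mono) (auto simp: cand_def)
  also have "\<dots> \<le> card (cand X W) + card {u \<in> core W. 1 \<le> oe u}" by (rule card_Un_le)
  also have "card {u \<in> core W. 1 \<le> oe u} \<le> sum oe {u \<in> core W. 1 \<le> oe u}"
    using sum_bounded_below[of "{u \<in> core W. 1 \<le> oe u}" 1 oe] by simp
  also have "\<dots> \<le> n - 3" using core_subset WV by (intro sum_oe) blast
  finally have "2 \<le> card (cand X W)" using 2(3) n by linarith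
  then show ?thesis ..
qed

text \<open>Take \<open>X = {x}\<close>, which hits \<open>W1\<close>. At least \<open>n - 1\<close>
  in-neighbours of \<open>x\<close> lie in \<open>W1\<close>, so any other cluster sends at most
  \<open>ie x + 1\<close> arcs to \<open>x\<close>. With fewer than two candidates it must therefore
  have large out-excess; if none is like that, the transversal exists.\<close>

lemma other_high_core:
  assumes W1: "W1 \<in> clusters" and x: "x \<in> core W1" "0 < oe x"
  shows "\<exists>W\<in>clusters. W \<noteq> W1 \<and> core W = W \<and> n - 2 \<le> sum oe W + ie x \<and> (\<exists>u\<in>W. 0 < oe u)"
proof (rule ccontr)
  assume no: "\<not> ?thesis"
  have xV: "x \<in> V" "x \<in> W1" using x core_subset cluster_subset(1)[OF W1] by auto
  have two: "2 \<le> card (cand {x} W)" if W: "W \<in> clusters - {W1}" for W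
  proof (rule ccontr)
    assume few: "\<not> ?thesis"
    have WC: "W \<in> clusters" "W \<noteq> W1" using W by auto
    have "W \<inter> {x} = {}" using clusters_disjoint[OF WC(1) W1 WC(2)] xV by auto
    from card_cand[OF WC(1) this] few xV
    have W': "core W = W" "n \<le> 1 + sum oe W + arcs_into x W" by auto
    have "arcs_into x W1 + arcs_into x W \<le> n + ie x"
      using arcs_into_two[OF W1 WC(1) not_sym[OF WC(2)] xV(1)] .
    then have le: "n - 2 \<le> sum oe W + ie x" using W'(2) arcs_into_own_cluster[OF W1 xV(2)] by simp
    have "ie x \<le> n - 3" using sum_ie[of "{x}"] xV by simp
    then have "sum oe W \<noteq> 0" using le n by simp
    then have "\<exists>u\<in>W. 0 < oe u" using cluster_subset(2)[OF WC(1)] by auto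
    with no WC W'(1) le show False by blast
  qed
  show False
  proof (rule transversal_contradiction[of "{x}" x "clusters - {W1}"])
    show "acyclic_in E {x}" by (rule acyclic_in_singleton[OF noloop])
    show "cand {x} W \<noteq> {}" if "W \<in> clusters - {W1}" for W using two[OF that] by auto
  qed (use x xV two in auto)
qed

text \<open>
  Otherwise the previous lemma applies to \<open>x\<close> and then to a vertex \<open>u\<close> it provides; the in-excesses of \<open>x\<close>
  and \<open>u\<close> and the out-excesses of the two clusters obtained are together too large.
\<close>

lemma no_high_core:
  assumes W1: "W1 \<in> clusters" and x: "x \<in> core W1"
  shows "oe x = 0"
proof (rule ccontr)
  assume "oe x \<noteq> 0"
  then obtain W u where W: "W \<in> clusters" "W \<noteq> W1" "core W = W" "n - 2 \<le> sum oe W + ie x"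
    and u: "u \<in> W" "0 < oe u" using other_high_core[OF W1 x] by auto
  \<comment> \<open>As \<open>W\<close> is its own core, the lemma applies to \<open>u\<close> as
    well; \<open>W'\<close> may be \<open>W1\<close>, only its difference from \<open>W\<close>
    matters.\<close>
  obtain W' where W': "W' \<in> clusters" "W' \<noteq> W" "n - 2 \<le> sum oe W' + ie u"
    using other_high_core[OF W(1), of u] W(3) u by auto
  have sub: "W1 \<subseteq> V" "W \<subseteq> V" "W' \<subseteq> V" and f: "finite W" "finite W'"
    using cluster_subset W1 W W' by auto
  have "u \<noteq> x" using clusters_disjoint[OF W(1) W1 W(2)] u x core_subset by blast
  then have "ie x + ie u \<le> n - 3" using sum_ie[of "{x, u}"] x u core_subset sub by auto
  moreover have "W \<inter> W' = {}" using clusters_disjoint W W' by blast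
  then have "sum oe W + sum oe W' \<le> n - 3"
    using sum_oe[of "W \<union> W'"] sub f by (simp add: sum.union_disjoint)
  ultimately show False using W(4) W'(3) n by simp
qed

lemma card_cand_low_core:
  assumes W: "W \<in> clusters" and X: "W \<inter> X = {}" "X \<subseteq> V"
  shows "2 \<le> card (cand X W) \<or> card W = n \<and> n \<le> card (cand X W) + (\<Sum>x\<in>X. arcs_into x W)"
proof -
  have "sum oe W = 0" if "core W = W" using no_high_core[OF W] that by simp
  then show ?thesis using card_cand[OF assms] by auto
qed

text \<open>Take for \<open>X\<close> the two vertices outside the core. They receive at least
  \<open>2 * n - 2\<close> arcs from \<open>W0\<close>, hence at most \<open>n - 1\<close> from all
  other clusters together: too few to block all \<open>n\<close> vertices of one cluster, or
  \<open>n - 1\<close> in each of two.\<close>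

lemma no_high_in_cluster:
  assumes W0: "W0 \<in> clusters" and x: "x \<in> W0"
  shows "oe x = 0"
proof (rule ccontr)
  assume hi: "oe x \<noteq> 0"
  then have xc: "x \<notin> core W0" using no_high_core[OF W0, of x] by auto
  from W0 show False
  proof (cases rule: cluster_shape)
    case 1
    then show ?thesis using x xc by simp
  next
    case (2 y z)
    have yz: "y \<in> W0" "z \<in> W0" "x = y \<or> x = z" using 2(2) x xc by auto
    have yzV: "{y, z} \<subseteq> V" using yz cluster_subset(1)[OF W0] by auto
    have ie: "ie y + ie z \<le> n - 3" using sum_ie[OF yzV] 2(1) by simp
    have own: "2 * n - 2 \<le> arcs_into y W0 + arcs_into z W0"
      using arcs_into_own_cluster[OF W0 yz(1)] arcs_into_own_cluster[OF W0 yz(2)] by simp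
    have cc: "2 \<le> card (cand {y, z} W) \<or> n \<le> card (cand {y, z} W) + (arcs_into y W + arcs_into z W)"
      if "W \<in> clusters - {W0}" for W
      using card_cand_low_core[of W "{y, z}"] clusters_disjoint[OF _ W0, of W] that yz(1,2) yzV 2(1) by auto
    show ?thesis
    proof (rule transversal_contradiction[of "{y, z}" x "clusters - {W0}"])
      show "acyclic_in E {y, z}" using irr 2(4) by (rule acyclic_in_pair)
      fix W assume W: "W \<in> clusters - {W0}"
      show "cand {y, z} W \<noteq> {}"
      proof
        assume "cand {y, z} W = {}"
        then have "n \<le> arcs_into y W + arcs_into z W" using cc[OF W] by simp
        moreover have "arcs_into y W0 + arcs_into y W \<le> n + ie y" "arcs_into z W0 + arcs_into z W \<le> n + ie z"
          using arcs_into_two[OF W0, of W] W yzV by (simp_all add: eq_commute)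
        ultimately show False using own ie n by simp
      qed
      fix W' assume W': "W' \<in> clusters - {W0}" "W \<noteq> W'"
      show "2 \<le> card (cand {y, z} W) \<or> 2 \<le> card (cand {y, z} W')"
      proof (rule ccontr)
        assume "\<not> ?thesis"
        then have "n \<le> 1 + (arcs_into y W + arcs_into z W)" "n \<le> 1 + (arcs_into y W' + arcs_into z W')"
          using cc[OF W] cc[OF W'(1)] by linarith+
        moreover have "arcs_into y W0 + (arcs_into y W + arcs_into y W') \<le> n + ie y" "arcs_into z W0 + (arcs_into z W + arcs_into z W') \<le> n + ie z"
          using arcs_into_three[OF W0, of W W'] W W' yzV by (simp_all add: eq_commute)
        ultimately show False using own ie n by linarith
      qed
    next
      fix W assume "W \<in> clusters - (clusters - {W0})"
      then show "core W \<inter> {y, z} \<noteq> {} \<or> W \<noteq> core W \<and> W - core W \<subseteq> {y, z}" using 2(2) by auto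
    qed (use yz yzV hi in auto)
  qed
qed

text \<open>Now \<open>x\<close> lies in no cluster. Its in-degree is at most
  \<open>2 * n - 3\<close>, so no two clusters can each send \<open>n - 1\<close> arcs to
  \<open>x\<close>; the only obstacle to \<open>X = {x}\<close> is a cluster without
  candidates.\<close>

lemma no_high:
  assumes x: "x \<in> V"
  shows "oe x = 0"
proof (rule ccontr)
  assume hi: "oe x \<noteq> 0"
  then have notin: "x \<notin> W" if "W \<in> clusters" for W using no_high_in_cluster[OF that, of x] by auto
  have cc: "2 \<le> card (cand {x} W) \<or> card W = n \<and> n \<le> card (cand {x} W) + arcs_into x W"
    if "W \<in> clusters" for W
    using card_cand_low_core[of W "{x}"] that notin x by auto
  have ie: "ie x \<le> n - 3" using sum_ie[of "{x}"] x by simp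
  (* Some cluster W sends an arc from each of its vertices to x, and then {x, u} with u in W and
     without the arc from x to u can replace {x}. *)
  have "\<exists>W\<in>clusters. cand {x} W = {}"
  proof (rule ccontr)
    assume ne: "\<not> ?thesis"
    show False
    proof (rule transversal_contradiction[of "{x}" x clusters])
      show "acyclic_in E {x}" by (rule acyclic_in_singleton[OF noloop])
      fix W W' assume W: "W \<in> clusters" "W' \<in> clusters" "W \<noteq> W'"
      show "2 \<le> card (cand {x} W) \<or> 2 \<le> card (cand {x} W')"
      proof (rule ccontr)
        assume "\<not> ?thesis"
        then have "n \<le> 1 + arcs_into x W" "n \<le> 1 + arcs_into x W'" using cc[OF W(1)] cc[OF W(2)] by linarith+
        moreover have "arcs_into x W + arcs_into x W' \<le> n + ie x" using arcs_into_two[OF W x] .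
        ultimately show False using ie n by linarith
      qed
    qed (use ne hi x in auto)
  qed
  then obtain W where W: "W \<in> clusters" "cand {x} W = {}" by blast
  then have cW: "card W = n" "n \<le> arcs_into x W" using cc[OF W(1)] by auto
  have finW: "finite W" and WV: "W \<subseteq> V" using cluster_subset[OF W(1)] by auto
  have all_in: "W \<subseteq> E\<inverse> `` {x}"
  proof -
    have "E\<inverse> `` {x} \<inter> W = W" using cW finW unfolding arcs_into_def by (intro card_seteq) auto
    then show ?thesis by blast
  qed
  have coreW: "core W = W"
    using W(1)
  proof (cases rule: cluster_shape)
    case (2 y z)
    have "card (W - core W) = card W - card (core W)"
      using finW core_subset finite_subset by (intro card_Diff_subset) blast+
    then show ?thesis using 2 cW n by simp
  qed
  have "\<exists>u\<in>W. (x, u) \<notin> E"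
  proof (rule ccontr)
    assume "\<not> ?thesis"
    then have "clique E (insert x W)" using all_in coreW by (auto simp: clique_def core_def)
    moreover have "insert x W \<subseteq> V" "card (insert x W) = n + 1" using x WV finW cW notin[OF W(1)] by auto
    ultimately show False using no_big_clique by blast
  qed
  then obtain u where u: "u \<in> W" "(x, u) \<notin> E" by blast
  have ux: "u \<noteq> x" "u \<in> V" using u notin[OF W(1)] WV by auto
  have ie': "ie x + ie u \<le> n - 3" using sum_ie[of "{x, u}"] x ux by auto
  \<comment> \<open>Another cluster sends at most \<open>ie x\<close> arcs to \<open>x\<close> and
    \<open>ie u + 1\<close> to \<open>u\<close>, together at most \<open>n - 2\<close>.\<close>
  have two: "2 \<le> card (cand {x, u} W')" if W': "W' \<in> clusters - {W}" for W'
  proof (rule ccontr)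
    assume few: "\<not> ?thesis"
    have "W' \<inter> {x, u} = {}" using notin[of W'] clusters_disjoint[OF W(1), of W'] W' u by auto
    with card_cand_low_core[of W' "{x, u}"] few W' x ux have "n \<le> 1 + (arcs_into x W' + arcs_into u W')" by auto
    moreover have "arcs_into x W + arcs_into x W' \<le> n + ie x" "arcs_into u W + arcs_into u W' \<le> n + ie u"
      using arcs_into_two[OF W(1), of W'] W' x ux(2) by (simp_all add: eq_commute)
    moreover have "n - 1 \<le> arcs_into u W" using arcs_into_own_cluster[OF W(1) u(1)] .
    ultimately show False using cW(2) ie' n by linarith
  qed
  show False
  proof (rule transversal_contradiction[of "{x, u}" x "clusters - {W}"])
    show "acyclic_in E {x, u}" using irr u(2) by (intro acyclic_in_pair) auto
    show "cand {x, u} W' \<noteq> {}" if "W' \<in> clusters - {W}" for W' using two[OF that] by auto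
    show "core W' \<inter> {x, u} \<noteq> {} \<or> W' \<noteq> core W' \<and> W' - core W' \<subseteq> {x, u}"
      if "W' \<in> clusters - (clusters - {W})" for W' using that coreW u by auto
  qed (use x ux hi two in auto)
qed

end

subsection \<open>Dirac's bound\<close>

text \<open>Extend \<open>I\<close> to a maximal acyclic \<open>J\<close> and take a critical
  \<open>W\<close> outside \<open>J\<close>. If \<open>W\<close> is not the required clique, the
  induction hypothesis bounds its arcs; the arcs from \<open>W\<close> to \<open>J\<close> and the
  surplus out-arc of \<open>x\<close> then add up to the bound that \<open>few\<close>
  denies.\<close>

lemma acyclic_superset_missing_clique:
  assumes IH: "\<And>W. vcritical n E W \<Longrightarrow> n = 2 \<or> \<not> (clique E W \<and> card W = n + 1) \<Longrightarrow>
      n * card W + (n - 2) \<le> card (Restr E W)"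
    and n: "2 \<le> n" and irr: "irrefl E" and crit: "vcritical (Suc n) E V"
    and few: "card (Restr E V) < Suc n * card V + (Suc n - 2)"
    and I: "I \<subseteq> V" "acyclic_in E I" and x: "x \<in> I" "Suc n < outdeg E V x"
  shows "\<exists>Q\<subseteq>V - I. clique E Q \<and> card Q = Suc n"
proof -
  have fin: "finite V" using crit by (simp add: vcritical_def)
  define \<J> where "\<J> = {J. J \<subseteq> V \<and> acyclic_in E J}"
  have "finite \<J>" by (rule finite_subset[of _ "Pow V"]) (use fin in \<open>auto simp: \<J>_def\<close>)
  moreover have "I \<in> \<J>" using I by (simp add: \<J>_def)
  ultimately obtain J where "J \<in> \<J>" "I \<subseteq> J" and "\<forall>J'\<in>\<J>. J \<subseteq> J' \<longrightarrow> J = J'"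
    using finite_has_maximal2[of \<J> I] by auto
  then have J: "J \<subseteq> V" "acyclic_in E J" "I \<subseteq> J"
    and max: "\<And>J'. J' \<subseteq> V \<Longrightarrow> acyclic_in E J' \<Longrightarrow> J \<subseteq> J' \<Longrightarrow> J = J'"
    by (simp_all add: \<J>_def)
  have "\<not> (\<exists>f. colouring n E (V - J) f)"
  proof
    assume "\<exists>f. colouring n E (V - J) f"
    then obtain f where f: "colouring n E (V - J) f" ..
    \<comment> \<open>All of \<open>J\<close> receives the additional colour
      \<open>n\<close>.\<close>
    define h where "h v = (if v \<in> J then n else f v)" for v
    have "colouring (Suc n) E V h"
      unfolding colouring_def
    proof (intro conjI ballI allI)
      fix v assume "v \<in> V"
      then show "h v < Suc n" using f by (auto simp: h_def colouring_def less_Suc_eq)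
    next
      fix i
      show "acyclic_in E {v \<in> V. h v = i}"
      proof (cases "i = n")
        case True
        have "{v \<in> V. h v = i} \<subseteq> J" using f True by (auto simp: h_def colouring_def)
        then show ?thesis using J(2) by (rule acyclic_in_mono[rotated])
      next
        case False
        have "{v \<in> V. h v = i} \<subseteq> {v \<in> V - J. f v = i}" using False by (auto simp: h_def)
        moreover have "acyclic_in E {v \<in> V - J. f v = i}" using f by (simp add: colouring_def)
        ultimately show ?thesis by (rule acyclic_in_mono[rotated])
      qed
    qed
    then show False using crit by (auto simp: vcritical_def)
  qed
  then obtain W where W: "W \<subseteq> V - J" "vcritical n E W"
    using ex_vcritical_subset[of "V - J" n E] fin by auto
  have finW: "finite W" using W(2) by (simp add: vcritical_def)
  show ?thesis
  proof (rule ccontr)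
    assume "\<not> ?thesis"
    then have "\<not> (clique E W \<and> card W = n + 1)" using W(1) J(3) by auto
    then have arcsW: "n * card W + (n - 2) \<le> (\<Sum>v\<in>W. outdeg E W v)"
      using IH[OF W(2)] card_Restr[OF finW, of E] by simp
    have step: "outdeg E W v + 1 \<le> outdeg E V v" if v: "v \<in> W" for v
    proof -
      have "E `` {v} \<inter> J \<noteq> {}"
      proof
        assume "E `` {v} \<inter> J = {}"
        then have "acyclic_in E (insert v J)"
          using J(2) irr by (intro acyclic_in_insert_sink) (auto simp: irrefl_def)
        then have "J = insert v J" using max[of "insert v J"] v W(1) J(1) by auto
        then show False using v W(1) by auto
      qed
      then have "E `` {v} \<inter> W \<subset> E `` {v} \<inter> V" using W(1) J(1) by auto
      then have "outdeg E W v < outdeg E V v" using fin by (intro psubset_card_mono) auto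
      then show ?thesis by simp
    qed
    have xW: "x \<in> V - W" using x(1) I(1) J(3) W(1) by auto
    have WV: "W \<subseteq> V" using W(1) by auto
    \<comment> \<open>The conditional summand records the surplus of \<open>x\<close>, which
      provides the increase from \<open>n - 2\<close> to \<open>Suc n - 2\<close>.\<close>
    have "(\<Sum>v\<in>V - W. Suc n + (if v = x then 1 else 0)) \<le> (\<Sum>v\<in>V - W. outdeg E V v)"
      using vcritical_outdeg[OF crit irr] x(2) by (intro sum_mono) auto
    moreover have "(\<Sum>v\<in>V - W. Suc n + (if v = x then 1 else 0)) = Suc n * card (V - W) + 1"
      unfolding sum.distrib using xW fin by simp
    moreover have "(\<Sum>v\<in>W. outdeg E W v + 1) \<le> (\<Sum>v\<in>W. outdeg E V v)" using step by (rule sum_mono)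
    moreover have "(\<Sum>v\<in>W. outdeg E W v + 1) = (\<Sum>v\<in>W. outdeg E W v) + card W"
      unfolding sum.distrib by simp
    moreover have "card (Restr E V) = (\<Sum>v\<in>V - W. outdeg E V v) + (\<Sum>v\<in>W. outdeg E V v)"
      using card_Restr[OF fin, of E] sum.subset_diff[OF WV fin] by simp
    ultimately have "Suc n * card (V - W) + 1 + (n * card W + (n - 2) + card W) \<le> card (Restr E V)"
      using arcsW by linarith
    moreover have "card V = card (V - W) + card W"
      using card_Diff_subset[OF finW WV] card_mono[OF fin WV] by simp
    then have "Suc n * card V = Suc n * card (V - W) + (n * card W + card W)"
      by (simp add: algebra_simps)
    ultimately show False using few n by linarith
  qed
qed

text \<open>The disjunct \<open>n = 2\<close> admits the complete digraph on three vertices, for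
  which the bound is tight, so that the induction can start there.\<close>

theorem vcritical_arcs:
  assumes "2 \<le> n" "irrefl E" "vcritical n E V" "n = 2 \<or> \<not> (clique E V \<and> card V = n + 1)"
  shows "n * card V + (n - 2) \<le> card (Restr E V)"
  using assms(1,3,4)
proof (induction n arbitrary: V rule: dec_induct)
  case base
  have fin: "finite V" using base by (simp add: vcritical_def)
  have "(\<Sum>v\<in>V. 2) \<le> (\<Sum>v\<in>V. outdeg E V v)"
    using vcritical_outdeg[OF base(1) assms(2)] by (intro sum_mono) auto
  then show ?case using card_Restr[OF fin, of E] by simp
next
  case (step n)
  let ?m = "Suc n"
  note crit = step.prems(1)
  have fin: "finite V" using crit by (simp add: vcritical_def)
  have nclq: "\<not> (clique E V \<and> card V = ?m + 1)" using step by auto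
  have deg: "outdeg E V v = ?m + (outdeg E V v - ?m)" if "v \<in> V" for v
    using vcritical_outdeg[OF crit assms(2) that] by simp
  have ideg: "outdeg (E\<inverse>) V v = ?m + (outdeg (E\<inverse>) V v - ?m)" if "v \<in> V" for v
    using vcritical_outdeg[of ?m "E\<inverse>" V v] crit assms(2) that by (simp add: irrefl_def)
  show ?case
  proof (rule ccontr)
    assume "\<not> ?case"
    then have few: "card (Restr E V) < ?m * card V + (?m - 2)" by simp
    have "card (Restr E V) = (\<Sum>v\<in>V. ?m + (outdeg E V v - ?m))"
      unfolding card_Restr[OF fin] using deg by (rule sum.cong[OF refl])
    then have arcs: "card (Restr E V) = ?m * card V + (\<Sum>v\<in>V. outdeg E V v - ?m)"
      by (simp only: sum.distrib sum_constant) simp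
    then have excess: "(\<Sum>v\<in>V. outdeg E V v - ?m) \<le> ?m - 3" using few by linarith
    \<comment> \<open>If all out-degrees equal \<open>?m\<close>, counting arcs gives the same for
      in-degrees, and Brooks' theorem makes \<open>V\<close> the excluded clique.\<close>
    have "\<exists>x\<in>V. ?m < outdeg E V x"
    proof (rule ccontr)
      assume no: "\<not> ?thesis"
      then have out: "outdeg E V v = ?m" if "v \<in> V" for v using deg[OF that] that by fastforce
      then have "card (Restr E V) = ?m * card V" using arcs by simp
      moreover have "card (Restr (E\<inverse>) V) = card ((Restr E V)\<inverse>)" by (rule arg_cong[of _ _ card]) auto
      ultimately have "card (Restr (E\<inverse>) V) = ?m * card V" by (simp only: card_inverse)
      moreover have "card (Restr (E\<inverse>) V) = (\<Sum>v\<in>V. ?m + (outdeg (E\<inverse>) V v - ?m))"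
        unfolding card_Restr[OF fin] using ideg by (rule sum.cong[OF refl])
      then have "card (Restr (E\<inverse>) V) = ?m * card V + (\<Sum>v\<in>V. outdeg (E\<inverse>) V v - ?m)"
        by (simp only: sum.distrib sum_constant) simp
      ultimately have "(\<Sum>v\<in>V. outdeg (E\<inverse>) V v - ?m) = 0" by linarith
      then have "\<forall>v\<in>V. outdeg (E\<inverse>) V v - ?m = 0" using fin by (simp only: sum_eq_0_iff)
      then have "outdeg (E\<inverse>) V v = ?m" if "v \<in> V" for v using ideg[OF that] that by (metis add_0_right)
      moreover have "V \<noteq> {}" using crit by (auto simp: vcritical_def colouring_def)
      ultimately have "clique E V \<and> card V = ?m + 1"
        using directed_Brooks[OF crit assms(2) _ _ out] step.hyps by simp
      then show False using nclq by blast
    qed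
    then obtain x where x: "x \<in> V" "?m < outdeg E V x" ..
    have "outdeg E V x - ?m \<le> (\<Sum>v\<in>V. outdeg E V v - ?m)" using x fin by (intro member_le_sum) auto
    \<comment> \<open>A positive excess of at most \<open>?m - 3\<close> leaves only
      \<open>?m\<close> at least 4.\<close>
    then have m: "4 \<le> ?m" using x excess by linarith
    interpret low_excess ?m E V
    proof
      fix Q assume Q: "clique E Q" "Q \<subseteq> V"
      show "card Q \<noteq> ?m + 1"
      proof
        assume "card Q = ?m + 1"
        then have "Q = V" using vcritical_clique_eq[OF crit Q(1) _ Q(2)] by simp
        then show False using nclq Q \<open>card Q = ?m + 1\<close> by simp
      qed
    next
      fix I y assume I: "I \<subseteq> V" "acyclic_in E I" "y \<in> I" "?m < outdeg E V y"
      show "\<exists>Q\<subseteq>V - I. clique E Q \<and> card Q = ?m"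
        by (rule acyclic_superset_missing_clique[OF step.IH step.hyps(1) assms(2) crit few I])
    qed (use assms(2) crit m excess in auto)
    show False using no_high[OF x(1)] x by (simp add: oe_def)
  qed
qed


section \<open>Translation between digraphs with labelled arcs and relations\<close>

lemma acyclic_digraph_iff:
  assumes "wf_digraph H"
  shows "acyclic_digraph H \<longleftrightarrow> acyclic (arcs_ends H)"
proof -
  interpret wf_digraph H by fact
  \<comment> \<open>Every nonempty closed walk contains a cycle, and nonempty walks are what the
    transitive closure describes.\<close>
  have "(\<exists>p. cycle p) \<longleftrightarrow> (\<exists>u p. awalk u p u \<and> p \<noteq> [])"
    using closed_w_imp_cycle by (auto simp: cycle_def closed_w_def)
  then show ?thesis
    by (simp add: acyclic_digraph_def acyclic_def reachable1_awalk)
qed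

lemma (in wf_digraph) arcs_ends_induce: "arcs_ends (G \<restriction> S) = Restr (arcs_ends G) S"
  by (auto simp: arcs_ends_conv)

lemma (in wf_digraph) acyclic_induce_iff:
  assumes "S \<subseteq> verts G"
  shows "acyclic_digraph (G \<restriction> S) \<longleftrightarrow> acyclic_in (arcs_ends G) S"
proof -
  have "wf_digraph (G \<restriction> S)" by unfold_locales auto
  then show ?thesis by (simp add: acyclic_digraph_iff arcs_ends_induce acyclic_in_def)
qed

lemma (in wf_digraph) dicolouring_iff:
  "dicolouring G P \<longleftrightarrow> partition_on (verts G) P \<and> (\<forall>S\<in>P. acyclic_in (arcs_ends G) S)"
proof -
  have "S \<subseteq> verts G" if "partition_on (verts G) P" "S \<in> P" for S
    using that by (auto simp: partition_on_def)
  then show ?thesis unfolding dicolouring_def by (auto simp: acyclic_induce_iff)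
qed

lemma (in wf_digraph) dichromatic_number_le:
  assumes f: "colouring n (arcs_ends G) (verts G) f"
  shows "dichromatic_number G \<le> n"
proof -
  let ?c = "\<lambda>i. {v \<in> verts G. f v = i}"
  define P where "P = ?c ` {..<n} - {{}}"
  have "dicolouring G P"
    unfolding dicolouring_iff
  proof
    show "partition_on (verts G) P"
      using f by (intro partition_onI) (auto simp: P_def colouring_def disjnt_def)
    show "\<forall>S\<in>P. acyclic_in (arcs_ends G) S" using f by (auto simp: P_def colouring_def)
  qed
  moreover have "finite P" by (simp add: P_def)
  ultimately have "dichromatic_number G \<le> card P"
    unfolding dichromatic_number_def by (intro Least_le) blast
  also have "\<dots> \<le> card (?c ` {..<n})" unfolding P_def by (intro card_mono) auto
  also have "\<dots> \<le> n" using card_image_le[of "{..<n}" ?c] by simp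
  finally show ?thesis .
qed

lemma (in digraph) colouring_if_dichromatic_number_le:
  assumes n: "dichromatic_number G \<le> n"
  shows "\<exists>f. colouring n (arcs_ends G) (verts G) f"
proof -
  let ?Q = "\<lambda>m. \<exists>P. dicolouring G P \<and> finite P \<and> card P = m"
  have "(u, u) \<notin> arcs_ends G" for u using no_loops by (auto simp: arcs_ends_conv)
  \<comment> \<open>The partition into singletons ensures that the minimum is attained.\<close>
  then have "dicolouring G ((\<lambda>v. {v}) ` verts G)"
    unfolding dicolouring_iff partition_on_def by (auto simp: disjoint_def acyclic_in_singleton)
  then have "\<exists>m. ?Q m" by (meson finite_imageI finite_verts)
  then have "?Q (dichromatic_number G)" unfolding dichromatic_number_def by (rule LeastI_ex)
  then obtain P where P: "dicolouring G P" "finite P" "card P \<le> n" using n by auto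
  then have part: "partition_on (verts G) P" and acyc: "\<And>S. S \<in> P \<Longrightarrow> acyclic_in (arcs_ends G) S"
    by (auto simp: dicolouring_iff)
  obtain g where g: "bij_betw g P {0..<card P}" using ex_bij_betw_finite_nat[OF P(2)] by blast
  define blk where "blk v = (THE S. S \<in> P \<and> v \<in> S)" for v
  have blk: "blk v \<in> P" "v \<in> blk v" if v: "v \<in> verts G" for v
  proof -
    obtain S where S: "S \<in> P" "v \<in> S" using partition_onD1[OF part] v by auto
    have uniq: "S' = S" if S': "S' \<in> P" "v \<in> S'" for S'
    proof (rule ccontr)
      assume "S' \<noteq> S"
      then have "S' \<inter> S = {}" using disjointD[OF partition_onD2[OF part] S'(1) S(1)] by simp
      then show False using S(2) S'(2) by blast
    qed
    have "blk v = S" unfolding blk_def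
      by (rule the_equality) (use S in simp, erule conjE, rule uniq)
    with S show "blk v \<in> P" "v \<in> blk v" by simp_all
  qed
  have "colouring n (arcs_ends G) (verts G) (g \<circ> blk)"
    unfolding colouring_def
  proof (intro conjI ballI allI)
    fix v assume "v \<in> verts G"
    then have "g (blk v) \<in> {0..<card P}" using blk(1) g by (metis bij_betwE)
    then show "(g \<circ> blk) v < n" using P(3) by simp
  next
    fix i
    show "acyclic_in (arcs_ends G) {v \<in> verts G. (g \<circ> blk) v = i}"
    proof (cases "{v \<in> verts G. (g \<circ> blk) v = i} = {}")
      case True
      then show ?thesis by (simp only: acyclic_in_empty)
    next
      case False
      then obtain w where w: "w \<in> verts G" "g (blk w) = i" by auto
      have "{v \<in> verts G. (g \<circ> blk) v = i} \<subseteq> blk w"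
      proof
        fix v assume "v \<in> {v \<in> verts G. (g \<circ> blk) v = i}"
        then have v: "v \<in> verts G" "g (blk v) = g (blk w)" using w by auto
        then have "blk v = blk w" using g blk(1) w(1) by (meson bij_betw_imp_inj_on inj_onD)
        then show "v \<in> blk w" using blk(2)[OF v(1)] by simp
      qed
      then show ?thesis using acyc[OF blk(1)[OF w(1)]] by (rule acyclic_in_mono[rotated])
    qed
  qed
  then show ?thesis by blast
qed

text \<open>Deleting a vertex gives a proper subdigraph, whose dichromatic number is at most
  \<open>k - 1\<close>.\<close>

lemma dicritical_imp_vcritical:
  assumes crit: "dicritical k G" and k: "1 \<le> k"
  shows "vcritical (k - 1) (arcs_ends G) (verts G)"
proof -
  interpret digraph G using crit by (simp add: dicritical_def)
  have "\<exists>f. colouring (k - 1) (arcs_ends G) (verts G - {v}) f" if v: "v \<in> verts G" for v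
  proof -
    let ?H = "G \<restriction> (verts G - {v})"
    have sub: "subgraph ?H G" using induced_induce[of "verts G - {v}"] by auto
    then interpret H: digraph ?H by (rule digraph_subgraph)
    have "verts ?H \<noteq> verts G" using v by auto
    then have "?H \<noteq> G" by metis
    then have "dichromatic_number ?H \<le> k - 1" using crit sub by (simp add: dicritical_def)
    then obtain f where f: "colouring (k - 1) (arcs_ends ?H) (verts ?H) f"
      using H.colouring_if_dichromatic_number_le by blast
    have "Restr (Restr (arcs_ends G) (verts G - {v})) {u \<in> verts G - {v}. f u = i}
        = Restr (arcs_ends G) {u \<in> verts G - {v}. f u = i}" for i
      by auto
    then have "colouring (k - 1) (arcs_ends G) (verts G - {v}) f"
      using f unfolding colouring_def acyclic_in_def arcs_ends_induce induce_subgraph_verts by simp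
    then show ?thesis by blast
  qed
  moreover have "\<not> (\<exists>f. colouring (k - 1) (arcs_ends G) (verts G) f)"
  proof
    assume "\<exists>f. colouring (k - 1) (arcs_ends G) (verts G) f"
    then have "dichromatic_number G \<le> k - 1" using dichromatic_number_le by blast
    then show False using crit k by (simp add: dicritical_def)
  qed
  ultimately show ?thesis by (simp add: vcritical_def)
qed

theorem theorem1p4:
  fixes G :: "('a, 'b) pre_digraph" and k :: nat
  assumes "k \<ge> 4"
    and "dicritical k G"
    and "\<not> complete_digraph k G"
  shows "card (arcs G) \<ge> (k - 1) * card (verts G) + (k - 3)"
proof -
  interpret digraph G using assms(2) by (simp add: dicritical_def)
  let ?E = "arcs_ends G" and ?V = "verts G"
  have irr: "irrefl ?E" using no_loops by (auto simp: irrefl_def arcs_ends_conv)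
  have sub: "?E \<subseteq> {(u, v). (u, v) \<in> ?V \<times> ?V \<and> u \<noteq> v}"
    using no_loops by (auto simp: arcs_ends_conv)
  \<comment> \<open>Such a clique contains all arcs between distinct vertices, so \<open>G\<close>
    is symmetric and meets the library's notion of a complete digraph.\<close>
  have "\<not> (clique ?E ?V \<and> card ?V = k - 1 + 1)"
  proof
    assume cl: "clique ?E ?V \<and> card ?V = k - 1 + 1"
    then have eq: "?E = {(u, v). (u, v) \<in> ?V \<times> ?V \<and> u \<noteq> v}" using sub by (auto simp: clique_def)
    then have "symmetric G" unfolding symmetric_def by (auto intro: symI)
    then have "graph G" by unfold_locales
    then have "complete_digraph k G" using eq cl assms(1) by (simp add: complete_digraph_def)
    with assms(3) show False by contradiction
  qed
  then have "(k - 1) * card ?V + (k - 1 - 2) \<le> card (Restr ?E ?V)"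
    using dicritical_imp_vcritical[OF assms(2)] irr assms(1) by (intro vcritical_arcs) auto
  moreover have "Restr ?E ?V = ?E" using sub by auto
  \<comment> \<open>Passing from arcs to pairs of ends loses nothing, as there are no parallel
    arcs.\<close>
  moreover have "card ?E = card (arcs G)"
    unfolding arcs_ends_def by (rule card_image[OF inj_on_arc_to_ends])
  ultimately show ?thesis by simp
qed

end
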